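(* Let $(X_n)_{n\in\mathbb{N}}$ be a Wigner scheme defined on a probability space $(\Omega,\mathcal{A},\mathbb{P})$. For all $n\in\mathbb{N}$ define the real symmetric $n\times n$ random matrix $W_n$ by $W_n(i,j)=\frac{1}{\sqrt{n}}X_n(i,j)$ for $i,j\in\{1,\ldots,n\}$. Then the semicircle law holds for $(W_n)_n$ almost surely; that is, the empirical spectral distributions $\sigma_n$ of $W_n$ converge weakly almost surely to the semicircle distribution $\sigma$.
   Context: Wigner scheme: for every $n\in\mathbb{N}$, $X_n=(X_n(i,j))_{1\le i,j\le n}$ is a family of real-valued random variables such that (i) for all $q\in\mathbb{N}$ there is a constant $L_q\in(0,\infty)$ with $\mathbb{E}|X_n(i,j)|^q\le L_q$ for all $n\in\mathbb{N}$ and all $1\le i,j\le n$; (ii) $\mathbb{E}X_n(i,j)=0$ and $\mathrm{Var}(X_n(i,j))=1$ for all $n$, $i,j$; (iii) $X_n(i,j)=X_n(j,i)$ for all $n,i,j$; (iv) for each $n$ the family $(X_n(i,j))_{1\le i\le j\le n}$ is independent. (No independence between different $n$ is required.) Empirical spectral distribution (ESD) of a self-adjoint $n\times n$ random matrix $W$ with real eigenvalues $\lambda_1^W\le\ldots\le\lambda_n^W$ (counted with multiplicity): the random probability measure $\frac1n\sum_{l=1}^n\delta_{\lambda_l^{W}}$ on $\mathbb{R}$. Semicircle distribution $\sigma$: the probability measure on $\mathbb{R}$ with Lebesgue density $f_\sigma(x)=\frac{1}{2\pi}\sqrt{4-x^2}\,\mathbf{1}_{[-2,2]}(x)$. Weak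 convergence almost surely: for $\mathbb{P}$-almost all $\omega\in\Omega$, $\sigma_n(\omega)\to\sigma$ weakly, i.e. $\int f\,d\sigma_n(\omega)\to\int f\,d\sigma$ for all bounded continuous $f:\mathbb{R}\to\mathbb{R}$. *)

theory Defs
  imports "HOL-Probability.Probability" "Jordan_Normal_Form.Char_Poly"
begin

text \<open>
  Row and column indices run over \<open>{0..<n}\<close> instead of \<open>{1..n}\<close>, following the convention of
  \<open>Jordan_Normal_Form\<close>. At \<open>n = 0\<close> every condition below is vacuous.
  The Bochner integral of a non-integrable function is \<open>0\<close>, so finiteness of the absolute moments
  is stated through \<open>integrable\<close>.
\<close>

locale wigner_scheme = prob_space M for M :: "'a measure" +
  fixes X :: "nat \<Rightarrow> nat \<Rightarrow> nat \<Rightarrow> 'a \<Rightarrow> real"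
  assumes random_variable_entries:
      "\<And>n i j. i < n \<Longrightarrow> j < n \<Longrightarrow> random_variable borel (X n i j)"
    and moments:
      "\<And>q::nat. \<exists>L>0. \<forall>n. \<forall>i<n. \<forall>j<n.
         integrable M (\<lambda>\<omega>. \<bar>X n i j \<omega>\<bar> ^ q) \<and> expectation (\<lambda>\<omega>. \<bar>X n i j \<omega>\<bar> ^ q) \<le> L"
    and centered: "\<And>n i j. i < n \<Longrightarrow> j < n \<Longrightarrow> expectation (X n i j) = 0"
    and unit_variance: "\<And>n i j. i < n \<Longrightarrow> j < n \<Longrightarrow> variance (X n i j) = 1"
    and symmetric_entries:
      "\<And>n i j \<omega>. i < n \<Longrightarrow> j < n \<Longrightarrow> \<omega> \<in> space M \<Longrightarrow> X n i j \<omega> = X n j i \<omega>"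
    and independent_entries:
      "\<And>n. indep_vars (\<lambda>_. borel) (\<lambda>(i, j). X n i j) {(i, j). i \<le> j \<and> j < n}"

definition wigner_matrix :: "(nat \<Rightarrow> nat \<Rightarrow> nat \<Rightarrow> 'a \<Rightarrow> real) \<Rightarrow> nat \<Rightarrow> 'a \<Rightarrow> real mat" where
  "wigner_matrix X n \<omega> = Matrix.mat n n (\<lambda>(i, j). 1 / sqrt (real n) * X n i j \<omega>)"

text \<open>
  The real eigenvalues in increasing order, repeated according to their multiplicity as roots of
  the characteristic polynomial. For a symmetric matrix there are exactly \<open>dim_row A\<close> of
  them, see \<open>length_eigenvalue_list\<close>.
\<close>

definition eigenvalue_list :: "real mat \<Rightarrow> real list" where
  "eigenvalue_list A = sorted_list_of_multiset (proots (char_poly A))"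

definition esd :: "real mat \<Rightarrow> real measure" where
  "esd A = measure_of UNIV (sets borel)
     (\<lambda>B. (\<Sum>l<dim_row A. emeasure (return borel (eigenvalue_list A ! l)) B) / of_nat (dim_row A))"

definition semicircle_distribution :: "real measure" where
  "semicircle_distribution =
     density lborel (\<lambda>x. ennreal (1 / (2 * pi) * sqrt (4 - x\<^sup>2) * indicator {-2..2} x))"

text \<open>
  The library's \<open>weak_conv_m\<close> is convergence of distribution functions at continuity points; it
  is equivalent for probability measures, see \<open>weakly_converges_iff_weak_conv_m\<close>.
\<close>

definition weakly_converges :: "(nat \<Rightarrow> real measure) \<Rightarrow> real measure \<Rightarrow> bool" where
  "weakly_converges \<mu> \<nu> \<longleftrightarrow>
     (\<forall>f :: real \<Rightarrow> real. continuous_on UNIV f \<longrightarrow> bounded (range f) \<longrightarrow>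
        (\<lambda>n. integral\<^sup>L (\<mu> n) f) \<longlonglongrightarrow> integral\<^sup>L \<nu> f)"

lemma sets_esd [simp]: "sets (esd A) = sets borel"
  and space_esd [simp]: "space (esd A) = UNIV"
proof -
  have "sigma_algebra UNIV (sets (borel :: real measure))"
    using sets.sigma_algebra_axioms[of "borel :: real measure"] by simp
  then show "sets (esd A) = sets borel"
    by (simp add: esd_def sigma_algebra.sigma_sets_eq)
  show "space (esd A) = UNIV" by (simp add: esd_def space_measure_of_conv)
qed

lemma emeasure_esd:
  assumes "B \<in> sets borel"
  shows "emeasure (esd A) B =
    (\<Sum>l<dim_row A. emeasure (return borel (eigenvalue_list A ! l)) B) / of_nat (dim_row A)"
    (is "_ = ?m B")
proof -
  let ?R = "\<lambda>l. return (borel :: real measure) (eigenvalue_list A ! l)"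
  have "positive (sets (esd A)) ?m" by (simp add: positive_def)
  moreover have "countably_additive (sets (esd A)) ?m"
  proof (rule countably_additiveI)
    fix F :: "nat \<Rightarrow> real set"
    assume F: "range F \<subseteq> sets (esd A)" "disjoint_family F" "\<Union> (range F) \<in> sets (esd A)"
    have "(\<Sum>i. ?m (F i)) = (\<Sum>i. \<Sum>l<dim_row A. emeasure (?R l) (F i)) / of_nat (dim_row A)"
      by simp
    also have "(\<Sum>i. \<Sum>l<dim_row A. emeasure (?R l) (F i)) =
        (\<Sum>l<dim_row A. \<Sum>i. emeasure (?R l) (F i))"
      by (rule suminf_sum) simp
    also have "\<dots> = (\<Sum>l<dim_row A. emeasure (?R l) (\<Union> (range F)))"
      using F by (intro sum.cong refl suminf_emeasure) auto
    finally show "(\<Sum>i. ?m (F i)) = ?m (\<Union> (range F))" .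
  qed
  ultimately show ?thesis
    using assms emeasure_measure_of[OF esd_def, of A B] sets_esd[of A] by auto
qed

lemma real_distribution_esd:
  assumes "0 < dim_row A"
  shows "real_distribution (esd A)"
proof -
  have "emeasure (esd A) (space (esd A)) = 1"
    using assms ennreal_divide_self[of "of_nat (dim_row A)"] by (simp add: emeasure_esd of_nat_less_top)
  then show ?thesis
    by (intro real_distribution.intro real_distribution_axioms.intro prob_spaceI) auto
qed

lemma weakly_converges_iff_weak_conv_m:
  assumes "\<And>n. real_distribution (\<mu> n)" "real_distribution \<nu>"
  shows "weakly_converges \<mu> \<nu> \<longleftrightarrow> weak_conv_m \<mu> \<nu>"
proof
  assume w: "weakly_converges \<mu> \<nu>"
  show "weak_conv_m \<mu> \<nu>"
    using assms
  proof (rule integral_bdd_continuous_conv_imp_weak_conv)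
    fix f :: "real \<Rightarrow> real"
    assume "\<And>x. isCont f x" "\<And>x. \<bar>f x\<bar> \<le> 1"
    then show "(\<lambda>n. integral\<^sup>L (\<mu> n) f) \<longlonglongrightarrow> integral\<^sup>L \<nu> f"
      using w unfolding weakly_converges_def
      by (metis boundedI continuous_at_imp_continuous_on rangeE real_norm_def)
  qed
next
  assume w: "weak_conv_m \<mu> \<nu>"
  show "weakly_converges \<mu> \<nu>"
    unfolding weakly_converges_def
  proof (intro allI impI)
    fix f :: "real \<Rightarrow> real"
    assume f: "continuous_on UNIV f" "bounded (range f)"
    obtain B where "\<And>x. \<bar>f x\<bar> \<le> B"
      using f(2) by (auto simp: bounded_iff)
    then show "(\<lambda>n. integral\<^sup>L (\<mu> n) f) \<longlonglongrightarrow> integral\<^sup>L \<nu> f"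
      using f(1) assms w
      by (intro weak_conv_imp_integral_bdd_continuous_conv)
         (auto simp: continuous_on_eq_continuous_at)
  qed
qed

lemma symmetric_eigenvalue_real:
  assumes A: "A \<in> carrier_mat n n" and sym: "transpose_mat A = A"
    and ev: "eigenvalue (map_mat complex_of_real A) a"
  shows "a \<in> \<real>"
proof -
  obtain v where v: "v \<in> carrier_vec n" "v \<noteq> 0\<^sub>v n"
      "map_mat complex_of_real A *\<^sub>v v = a \<cdot>\<^sub>v v"
    using ev A by (auto simp: eigenvalue_def eigenvector_def)
  define x where "x i = vec_index v i" for i
  define b where "b i j = index_mat A (i, j)" for i j
  have b_sym: "b i j = b j i" if "i < n" "j < n" for i j
    using that A arg_cong[OF sym, of "\<lambda>B. index_mat B (i, j)"] by (simp add: b_def)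
  have row: "(\<Sum>j<n. of_real (b i j) * x j) = a * x i" if "i < n" for i
    using arg_cong[OF v(3), of "\<lambda>w. vec_index w i"] that A v(1)
    by (simp add: scalar_prod_def x_def b_def lessThan_atLeast0)
  define S where "S = (\<Sum>i<n. (cmod (x i))\<^sup>2)"
  define T where "T = (\<Sum>i<n. \<Sum>j<n. cnj (x i) * of_real (b i j) * x j)"
  have T: "T = a * of_real S"
  proof -
    have "T = (\<Sum>i<n. cnj (x i) * (\<Sum>j<n. of_real (b i j) * x j))"
      by (simp add: T_def sum_distrib_left mult.assoc)
    also have "\<dots> = (\<Sum>i<n. a * (x i * cnj (x i)))"
      by (intro sum.cong) (auto simp: row)
    also have "\<dots> = a * of_real S"
      by (simp add: S_def sum_distrib_left complex_norm_square del: of_real_power)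
    finally show ?thesis .
  qed
  have "cnj T = (\<Sum>i<n. \<Sum>j<n. cnj (x j) * of_real (b j i) * x i)"
    unfolding T_def cnj_sum by (intro sum.cong refl) (simp add: b_sym)
  also have "\<dots> = T"
    unfolding T_def by (rule sum.swap)
  finally have "cnj a * of_real S = a * of_real S"
    by (simp add: T)
  moreover have "S \<noteq> 0"
  proof
    assume "S = 0"
    then have "x i = 0" if "i < n" for i
      using that by (simp add: S_def sum_nonneg_eq_0_iff)
    then have "v = 0\<^sub>v n"
      using v(1) by (intro eq_vecI) (auto simp: x_def)
    with v(2) show False by contradiction
  qed
  ultimately show "a \<in> \<real>"
    by (simp add: Reals_cnj_iff)
qed

lemma length_eigenvalue_list:
  assumes A: "A \<in> carrier_mat n n" and sym: "transpose_mat A = A"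
  shows "length (eigenvalue_list A) = n"
proof -
  let ?C = "map_mat complex_of_real A"
  have C: "?C \<in> carrier_mat n n" using A by simp
  obtain as where as: "char_poly ?C = (\<Prod>a\<leftarrow>as. [:- a, 1:])" "length as = n"
    using char_poly_factorized[OF C] by blast
  have real: "complex_of_real (Re a) = a" if "a \<in> set as" for a
  proof -
    have "poly (char_poly ?C) a = 0"
      using that by (auto simp: as(1) poly_prod_list prod_list_zero_iff)
    then have "a \<in> \<real>"
      using symmetric_eigenvalue_real[OF A sym] eigenvalue_root_char_poly[OF C] by blast
    then show ?thesis by simp
  qed
  have "map_poly complex_of_real (char_poly A) = (\<Prod>a\<leftarrow>as. [:- a, 1:])"
    using of_real_hom.char_poly_hom[OF A, where 'a = complex] as(1) by simp
  also have "\<dots> = map_poly complex_of_real (\<Prod>a\<leftarrow>as. [:- Re a, 1:])"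
    using real
  proof (induction as)
    case (Cons a as)
    have "complex_of_real (Re a) = a"
      using Cons.prems by simp
    moreover have "map_poly complex_of_real ([:- Re a, 1:] * (\<Prod>a\<leftarrow>as. [:- Re a, 1:])) =
        map_poly complex_of_real [:- Re a, 1:] * map_poly complex_of_real (\<Prod>a\<leftarrow>as. [:- Re a, 1:])"
      by (intro poly_eqI) (simp only: coeff_map_poly coeff_mult of_real_sum of_real_mult of_real_0)
    moreover have "map_poly complex_of_real [:- Re a, 1:] = [:- complex_of_real (Re a), 1:]"
      by (simp add: map_poly_pCons)
    ultimately show ?case
      using Cons by (simp del: mult_pCons_left)
  qed simp
  finally have "char_poly A = (\<Prod>a\<leftarrow>as. [:- Re a, 1:])"
    by (simp add: poly_eq_iff coeff_map_poly)
  moreover have "proots (\<Prod>a\<leftarrow>bs. [:- Re a, 1:]) = mset (map Re bs)" for bs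
  proof (induction bs)
    case (Cons b bs)
    have "(\<Prod>a\<leftarrow>bs. [:- Re a, 1:]) \<noteq> 0"
      by (auto simp: prod_list_zero_iff)
    then show ?case
      using Cons by (simp add: proots_mult del: mult_pCons_left)
  qed simp
  ultimately have "size (mset (eigenvalue_list A)) = n"
    using as(2) by (simp add: eigenvalue_list_def)
  then show ?thesis by simp
qed

end

(*
  Moment method. The k-th moment of the spectral distribution is a normalised sum, over the closed
  walks of length k on {0..<n}, of products of entries. Independence and centering annihilate every
  walk that uses some edge exactly once, and a connected graph has at most one vertex more than
  edges; so only walks running twice through each edge of a tree survive in the limit. Cutting such
  a walk at its first return to the root gives the Catalan recursion, hence the semicircle moments.
  The same count bounds the variance of the normalised trace by O(1/n^2): two correlated walks share
  an edge that is not a bridge, which costs one more vertex. This is summable, so all moments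
      converge
  almost surely without any independence between different n, and characteristic functions turn
  convergence of moments into weak convergence.
*)

theory Submission
  imports Defs "Jordan_Normal_Form.Schur_Decomposition"
begin

subsection \<open>Connected graphs and closed walks\<close>

text \<open>Walks on v vertices number about n^v, against a normalisation n^(k/2+1), so everything
  is a balance of vertices against edges. For fixed k the expectations attached to walks are bounded
  uniformly in n, hence constants depending on k are never tracked. Only the leading order needs
  exact values: a walk of length 2m on m+1 vertices uses every edge exactly twice, so its
  expectation is a product of variances, all equal to 1, and higher moments never reach the limit.
  The Catalan numbers arise in two forms: walks give the convolution, while integration by parts
  against the semicircle density gives a first order recursion; a generating function reconciles
  them. Moments identify the limit because the Catalan numbers are at most 4^m, so the Taylor
  expansion of the limiting characteristic function is controlled at every argument.\<close>

text \<open>Undirected edges, loops allowed, are encoded as pairs \<open>(i, j)\<close> with \<open>i \<le> j\<close>, which is the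
  index set
  of the independent entries.\<close>

definition edge :: "nat \<Rightarrow> nat \<Rightarrow> nat \<times> nat" where
  "edge a b = (min a b, max a b)"

definition adj :: "(nat \<times> nat) set \<Rightarrow> (nat \<times> nat) set" where
  "adj F = {(a, b). edge a b \<in> F}"

lemma edge_commute: "edge a b = edge b a"
  by (simp add: edge_def min.commute max.commute)

lemma edge_eq_iff: "edge a b = edge c d \<longleftrightarrow> a = c \<and> b = d \<or> a = d \<and> b = c"
  by (auto simp: edge_def min_def max_def)

lemma adj_mono: "F \<subseteq> F' \<Longrightarrow> adj F \<subseteq> adj F'"
  by (auto simp: adj_def)

lemma sym_rtrancl_adj: "sym ((adj F)\<^sup>*)"
  by (intro sym_rtrancl) (auto simp: sym_def adj_def edge_commute)

lemma rtrancl_adj_sym: "(a, b) \<in> (adj F)\<^sup>* \<Longrightarrow> (b, a) \<in> (adj F)\<^sup>*"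
  using sym_rtrancl_adj by (rule symD)

text \<open>The last edge of a shortest path from the root \<open>r\<close> to \<open>v\<close> determines \<open>v\<close>.\<close>

lemma card_reachable_le:
  assumes fin: "finite F" and reach: "\<And>v. v \<in> V \<Longrightarrow> (r, v) \<in> (adj F)\<^sup>*"
  shows "card V \<le> card F + 1"
proof -
  define d where "d v = (LEAST k. (r, v) \<in> adj F ^^ k)" for v
  have path: "(r, v) \<in> adj F ^^ d v" if v: "(r, v) \<in> (adj F)\<^sup>*" for v
    using rtrancl_imp_relpow[OF v] unfolding d_def by (auto intro: LeastI)
  have "\<exists>u. edge u v \<in> F \<and> d u < d v" if v: "v \<in> V - {r}" for v
  proof -
    have p: "(r, v) \<in> adj F ^^ d v" using path reach v by auto
    then obtain k where k: "d v = Suc k" using v by (cases "d v") auto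
    with p obtain u where u: "(r, u) \<in> adj F ^^ k" "(u, v) \<in> adj F" by auto
    then have "d u \<le> k" unfolding d_def by (intro Least_le)
    with u k show ?thesis by (auto simp: adj_def)
  qed
  then obtain p where p: "\<And>v. v \<in> V - {r} \<Longrightarrow> edge (p v) v \<in> F \<and> d (p v) < d v" by metis
  have "inj_on (\<lambda>v. edge (p v) v) (V - {r})"
  proof (rule inj_onI)
    fix u v assume "u \<in> V - {r}" "v \<in> V - {r}" "edge (p u) u = edge (p v) v"
    \<comment> \<open>If two distinct vertices shared this edge, each would be the predecessor of
      the other, and \<open>d\<close> would strictly decrease both ways.\<close>
    then show "u = v" using p[of u] p[of v] by (auto simp: edge_eq_iff)
  qed
  then have "card (V - {r}) \<le> card F"
    using p fin by (intro card_inj_on_le[of "\<lambda>v. edge (p v) v"]) blast+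
  then show ?thesis by (cases "r \<in> V") (auto simp: card_Diff_singleton)
qed

text \<open>Deleting an edge whose ends stay connected disconnects nothing, so the bound of
  \<open>card_reachable_le\<close> applies with one edge fewer.\<close>

lemma card_reachable_less:
  assumes fin: "finite F" and e: "edge a b \<in> F" and ab: "(a, b) \<in> (adj (F - {edge a b}))\<^sup>*"
    and reach: "\<And>v. v \<in> V \<Longrightarrow> (r, v) \<in> (adj F)\<^sup>*"
  shows "card V \<le> card F"
proof -
  let ?F = "F - {edge a b}"
  have "(x, y) \<in> (adj ?F)\<^sup>*" if "(x, y) \<in> adj F" for x y
  proof (cases "edge x y = edge a b")
    case True
    then show ?thesis using ab rtrancl_adj_sym[OF ab] by (auto simp: edge_eq_iff)
  next
    case False
    then show ?thesis using that by (intro r_into_rtrancl) (auto simp: adj_def)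
  qed
  then have "(adj F)\<^sup>* \<subseteq> (adj ?F)\<^sup>*" by (intro rtrancl_subset_rtrancl) auto
  then have "card V \<le> card ?F + 1" using fin reach by (intro card_reachable_le[of _ _ r]) auto
  then show ?thesis using card.remove[OF fin e] by simp
qed

section \<open>Walks as vertex lists and the edges they traverse\<close>

fun steps :: "nat list \<Rightarrow> (nat \<times> nat) list" where
  "steps (x # y # w) = edge x y # steps (y # w)"
| "steps _ = []"

lemma length_steps: "length (steps w) = length w - 1"
  by (induction w rule: steps.induct) auto

lemma steps_append:
  "u \<noteq> [] \<Longrightarrow> v \<noteq> [] \<Longrightarrow> steps (u @ v) = steps u @ edge (last u) (hd v) # steps v"
  by (induction u rule: steps.induct) (auto simp: neq_Nil_conv)

lemma steps_Cons: "w \<noteq> [] \<Longrightarrow> steps (x # w) = edge x (hd w) # steps w"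
  by (cases w) auto

lemma edge_in_steps_subset: "edge a b \<in> set (steps w) \<Longrightarrow> a \<in> set w \<and> b \<in> set w"
proof (induction w rule: steps.induct)
  case (1 x y w)
  then show ?case by (cases "edge a b = edge x y") (auto simp: edge_eq_iff)
qed auto

lemma fst_edge: "fst (edge a b) \<in> {a, b}"
  by (simp add: edge_def min_def)

lemma set_steps_subset: "e \<in> set (steps w) \<Longrightarrow> fst e \<in> set w"
  using fst_edge by (induction w rule: steps.induct) force+

lemma steps_disjoint:
  "set u \<inter> set v = {} \<Longrightarrow> set (steps u) \<inter> set (steps v) = {}"
  using set_steps_subset by blast

lemma steps_split:
  "e \<in> set (steps w) \<Longrightarrow> \<exists>u v. w = u @ v \<and> u \<noteq> [] \<and> v \<noteq> [] \<and> e = edge (last u) (hd v)"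
proof (induction w rule: steps.induct)
  case (1 x y w)
  show ?case
  proof (cases "e = edge x y")
    case True
    then show ?thesis by (intro exI[of _ "[x]"] exI[of _ "y # w"]) auto
  next
    case False
    then obtain u v where "y # w = u @ v" "u \<noteq> []" "v \<noteq> []" "e = edge (last u) (hd v)"
      using 1 by auto
    then show ?thesis by (intro exI[of _ "x # u"] exI[of _ v]) auto
  qed
qed auto

lemma walk_reachable_hd:
  "set (steps w) \<subseteq> F \<Longrightarrow> v \<in> set w \<Longrightarrow> (hd w, v) \<in> (adj F)\<^sup>*"
proof (induction w rule: steps.induct)
  case (1 x y w)
  then have "(x, y) \<in> adj F" by (simp add: adj_def)
  then show ?case using 1 by (auto intro: converse_rtrancl_into_rtrancl)
qed auto

lemma walk_reachable:
  "set (steps w) \<subseteq> F \<Longrightarrow> u \<in> set w \<Longrightarrow> v \<in> set w \<Longrightarrow> (u, v) \<in> (adj F)\<^sup>*"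
  using walk_reachable_hd rtrancl_adj_sym rtrancl_trans by metis

lemma card_set_walk_le: "card (set w) \<le> card (set (steps w)) + 1"
  by (rule card_reachable_le[of _ _ "hd w"]) (auto intro: walk_reachable_hd)

text \<open>Going round the closed walk \<open>w\<close> the other way avoids \<open>e\<close>, so \<open>e\<close> is not a bridge.\<close>

lemma closed_walk_avoid_edge:
  assumes closed: "hd w = last w" and once: "count_list (steps w) (edge a b) = 1"
  shows "(a, b) \<in> (adj (set (steps w) - {edge a b}))\<^sup>*"
proof -
  let ?e = "edge a b" let ?F = "set (steps w) - {?e}"
  have "?e \<in> set (steps w)" using once count_list_0_iff[of "steps w" ?e] by auto
  then obtain u v where uv: "w = u @ v" "u \<noteq> []" "v \<noteq> []" "?e = edge (last u) (hd v)"
    using steps_split by blast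
  then have st: "steps w = steps u @ ?e # steps v" by (simp add: steps_append)
  then have nin: "?e \<notin> set (steps u)" "?e \<notin> set (steps v)"
    using once by (auto simp: count_list_0_iff)
  have "(last u, hd u) \<in> (adj ?F)\<^sup>*"
    using uv nin st by (intro walk_reachable[of u]) auto
  moreover have "hd u = last v" using closed uv by simp
  moreover have "(last v, hd v) \<in> (adj ?F)\<^sup>*"
    using uv nin st by (intro walk_reachable[of v]) auto
  ultimately have "(last u, hd v) \<in> (adj ?F)\<^sup>*" by (auto intro: rtrancl_trans)
  moreover have "a = last u \<and> b = hd v \<or> a = hd v \<and> b = last u"
    using uv(4) by (simp add: edge_eq_iff)
  ultimately show ?thesis using rtrancl_adj_sym by blast
qed

lemma sum_count_list: "(\<Sum>e\<in>set xs. count_list xs e) = length xs"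
  by (rule sum_count_set) auto

lemma card_set_le_of_count_ge_2:
  assumes "\<And>e. e \<in> set xs \<Longrightarrow> 2 \<le> count_list xs e"
  shows "2 * card (set xs) \<le> length xs"
proof -
  have "(\<Sum>e\<in>set xs. 2) \<le> (\<Sum>e\<in>set xs. count_list xs e)" using assms by (intro sum_mono)
  then show ?thesis by (simp add: sum_count_list mult.commute)
qed

text \<open>Equality case of \<open>card_set_le_of_count_ge_2\<close>: the multiplicities add up to
  \<open>length xs\<close>, so a single one above 2 would exceed the total.\<close>

lemma count_eq_2:
  assumes ge: "\<And>e. e \<in> set xs \<Longrightarrow> 2 \<le> count_list xs e" and le: "length xs \<le> 2 * card (set xs)"
    and e: "e \<in> set xs"
  shows "count_list xs e = 2"
proof (rule ccontr)
  assume "count_list xs e \<noteq> 2"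
  then have "2 < count_list xs e" using ge[OF e] by auto
  then have "(\<Sum>e\<in>set xs. 2) < (\<Sum>e\<in>set xs. count_list xs e)"
    using ge e by (intro sum_strict_mono_ex1) auto
  then show False using le by (simp add: sum_count_list mult.commute)
qed

text \<open>Were there one more vertex, every edge of the union would be used exactly twice, so a common
  edge would
  be used once by each closed walk and hence would not be a bridge.\<close>

lemma card_two_closed_walks:
  assumes closed: "hd w = last w" "hd u = last u" and len: "length (steps w) = k" "length (steps
      u) = k"
    and ge: "\<And>e. e \<in> set (steps w @ steps u) \<Longrightarrow> 2 \<le> count_list (steps w @ steps u) e"
    and common: "set (steps w) \<inter> set (steps u) \<noteq> {}"
  shows "card (set (w @ u)) \<le> k"
proof -
  let ?xs = "steps w @ steps u"
  let ?F = "set ?xs"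
  obtain a b where ab: "edge a b \<in> set (steps w)" "edge a b \<in> set (steps u)"
  proof -
    obtain e where e: "e \<in> set (steps w)" "e \<in> set (steps u)" using common by blast
    moreover obtain a b where "e = edge a b" using steps_split[OF e(1)] by blast
    ultimately show ?thesis using that by blast
  qed
  have reach: "(a, v) \<in> (adj ?F)\<^sup>*" if "v \<in> set (w @ u)" for v
    using that walk_reachable[of w ?F a v] walk_reachable[of u ?F a v]
      edge_in_steps_subset[OF ab(1)] edge_in_steps_subset[OF ab(2)] by auto
  have F: "card ?F \<le> k" using card_set_le_of_count_ge_2[OF ge] len by simp
  show ?thesis
  proof (cases "card ?F = k")
    case True
    then have "count_list ?xs (edge a b) = 2"
      using ge ab len by (intro count_eq_2) auto
    then have "count_list (steps w) (edge a b) = 1"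
      using ab count_list_0_iff[of "steps w" "edge a b"] count_list_0_iff[of "steps u" "edge a b"]
          by auto
    then have "(a, b) \<in> (adj (set (steps w) - {edge a b}))\<^sup>*"
      by (rule closed_walk_avoid_edge[OF closed(1)])
    then have "(a, b) \<in> (adj (?F - {edge a b}))\<^sup>*"
      using rtrancl_mono[OF adj_mono[of "set (steps w) - {edge a b}" "?F - {edge a b}"]] by auto
    then have "card (set (w @ u)) \<le> card ?F"
      using ab reach by (intro card_reachable_less[of ?F a b _ a]) auto
    then show ?thesis using F by simp
  next
    case False
    have "card (set (w @ u)) \<le> card ?F + 1"
      using reach by (intro card_reachable_le[of _ _ a]) auto
    then show ?thesis using F False by simp
  qed
qed

subsection \<open>Counting walks\<close>

text \<open>A word with at most \<open>v\<close> letters is a pattern of length \<open>L\<close>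
  over \<open>{..<v}\<close> read through a dictionary of \<open>v\<close> letters. Only the
  dictionary depends on \<open>n\<close>, whence the power \<open>n ^ v\<close>.\<close>

lemma card_lists_few_values:
  assumes L: "0 < L"
  shows "card {w. length w = L \<and> set w \<subseteq> {..<n} \<and> card (set w) \<le> v} \<le> v ^ L * n ^ v"
proof -
  let ?P = "{p. set p \<subseteq> {..<v} \<and> length p = L}" and ?Q = "{g. set g \<subseteq> {..<n} \<and> length g = v}"
  have "{w. length w = L \<and> set w \<subseteq> {..<n} \<and> card (set w) \<le> v} \<subseteq> (\<lambda>(p, g). map (nth g) p) ` (?P \<times>
      ?Q)"
  proof
    fix w assume "w \<in> {w. length w = L \<and> set w \<subseteq> {..<n} \<and> card (set w) \<le> v}"
    then have w: "length w = L" "set w \<subseteq> {..<n}" "card (set w) \<le> v" by auto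
    \<comment> \<open>Padding with a letter of \<open>w\<close> brings the dictionary to length
      exactly \<open>v\<close> without adding letters; \<open>0 < L\<close> makes
      \<open>hd w\<close> such a letter.\<close>
    define g where "g = sorted_list_of_set (set w) @ replicate (v - card (set w)) (hd w)"
    have "w \<noteq> []" using w L by auto
    then have set_g: "set g = set w" by (auto simp: g_def)
    have len_g: "length g = v" using w by (simp add: g_def)
    have "\<exists>i<v. g ! i = x" if "x \<in> set w" for x
      using that set_g len_g by (metis in_set_conv_nth)
    then obtain f where f: "\<And>x. x \<in> set w \<Longrightarrow> f x < v \<and> g ! f x = x" by metis
    have "w = map (nth g) (map f w)" using f by (auto intro: nth_equalityI)
    moreover have "map f w \<in> ?P" using f w by auto
    moreover have "g \<in> ?Q" using set_g len_g w by auto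
    ultimately show "w \<in> (\<lambda>(p, g). map (nth g) p) ` (?P \<times> ?Q)" 
      by (intro image_eqI[of _ _ "(map f w, g)"]) simp_all
  qed
  moreover have "finite (?P \<times> ?Q)"
    by (intro finite_cartesian_product finite_lists_length_eq finite_lessThan)
  ultimately have "card {w. length w = L \<and> set w \<subseteq> {..<n} \<and> card (set w) \<le> v} \<le> card (?P \<times> ?Q)"
    by (rule surj_card_le[rotated])
  then show ?thesis by (simp add: card_cartesian_product card_lists_length_eq)
qed

section \<open>Closed walks with the maximal number of vertices and their Catalan count\<close>

definition closed_walks :: "nat \<Rightarrow> nat \<Rightarrow> nat list set" where
  "closed_walks n k = {w. length w = k + 1 \<and> set w \<subseteq> {..<n} \<and> hd w = last w}"

lemma finite_closed_walks [simp]: "finite (closed_walks n k)"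
  by (rule finite_subset[OF _ finite_lists_length_eq[of "{..<n}" "k + 1"]])
     (auto simp: closed_walks_def)

text \<open>No tree is mentioned, but \<open>m + 1\<close> is the largest number of vertices that
  \<open>2 * m\<close> steps can reach when no edge is used just once, and attaining it forces the
  visited graph to be a tree.\<close>

definition tree_walks :: "nat \<Rightarrow> nat \<Rightarrow> nat list set" where
  "tree_walks n m = {w \<in> closed_walks n (2 * m). card (set w) = m + 1 \<and>
     (\<forall>e\<in>set (steps w). 2 \<le> count_list (steps w) e)}"

lemma finite_tree_walks [simp]: "finite (tree_walks n m)"
  by (simp add: tree_walks_def)

text \<open>Squeezed from two sides: repetition of edges leaves at most \<open>m\<close> of them,
  and connecting \<open>m + 1\<close> vertices takes at least \<open>m\<close>.\<close>

lemma tree_walks_card_edges: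
  assumes "w \<in> tree_walks n m"
  shows "card (set (steps w)) = m"
proof -
  have "2 * card (set (steps w)) \<le> length (steps w)"
    using assms by (intro card_set_le_of_count_ge_2) (auto simp: tree_walks_def)
  then show ?thesis using assms card_set_walk_le[of w]
    by (auto simp: tree_walks_def closed_walks_def length_steps)
qed

lemma tree_walks_count:
  assumes "w \<in> tree_walks n m" "e \<in> set (steps w)"
  shows "count_list (steps w) e = 2"
  using assms tree_walks_card_edges[OF assms(1)]
  by (intro count_eq_2) (auto simp: tree_walks_def closed_walks_def length_steps)

text \<open>In a tree every edge is a bridge: with a non-bridge among them, \<open>m\<close> edges
  would connect at most \<open>m\<close> vertices.\<close>

lemma tree_walks_not_reachable:
  assumes w: "w \<in> tree_walks n m" and e: "edge a b \<in> set (steps w)"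
  shows "(a, b) \<notin> (adj (set (steps w) - {edge a b}))\<^sup>*"
proof
  assume "(a, b) \<in> (adj (set (steps w) - {edge a b}))\<^sup>*"
  then have "card (set w) \<le> card (set (steps w))"
    using e by (intro card_reachable_less[of _ a b _ "hd w"]) (auto intro: walk_reachable_hd)
  then show False using w tree_walks_card_edges[OF w] by (auto simp: tree_walks_def)
qed

text \<open>Inverse of the first return decomposition: leave the root \<open>hd v\<close> for
  \<open>hd u\<close>, follow the excursion \<open>u\<close>, and step back to the root, where
  \<open>v\<close> begins.\<close>

definition join_walks :: "nat list \<Rightarrow> nat list \<Rightarrow> nat list" where
  "join_walks u v = hd v # u @ v"

text \<open>The root \<open>hd v\<close> does not occur in \<open>u\<close>, so its first
  reappearance marks the end of \<open>u\<close>; cutting there is a left inverse.\<close>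

lemma inj_on_join_walks:
  "inj_on (\<lambda>(u, v). join_walks u v) {(u, v). v \<noteq> [] \<and> set u \<inter> set v = {}}"
proof (rule inj_on_inverseI)
  fix x assume "x \<in> {(u, v :: nat list). v \<noteq> [] \<and> set u \<inter> set v = {}}"
  then obtain u v where x: "x = (u, v)" "v \<noteq> []" "set u \<inter> set v = {}" by auto
  then have "y \<noteq> hd v" if "y \<in> set u" for y using that by auto
  then have "takeWhile (\<lambda>y. y \<noteq> hd v) (u @ v) = u" "dropWhile (\<lambda>y. y \<noteq> hd v) (u @ v) = v"
    using x(2) by (auto simp: takeWhile_append2 dropWhile_append2 takeWhile_eq_Nil_iff
        dropWhile_eq_self_iff)
  then show "(\<lambda>w. (takeWhile (\<lambda>y. y \<noteq> hd w) (tl w), dropWhile (\<lambda>y. y \<noteq> hd w) (tl w)))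
      ((\<lambda>(u, v). join_walks u v) x) = x"
    by (simp add: x join_walks_def)
qed

definition disjoint_pairs :: "nat \<Rightarrow> nat \<Rightarrow> nat \<Rightarrow> (nat list \<times> nat list) set" where
  "disjoint_pairs n a b = {(u, v) \<in> tree_walks n a \<times> tree_walks n b. set u \<inter> set v = {}}"

lemma tree_walks_nonempty: "w \<in> tree_walks n m \<Longrightarrow> w \<noteq> []"
  by (auto simp: tree_walks_def closed_walks_def)

text \<open>The connecting edge is crossed once each way, edges of \<open>u\<close> and
  \<open>v\<close> stay repeated, and the disjoint vertex sets add up to
  \<open>(a + 1) + (b + 1)\<close>.\<close>

lemma join_walks_tree_walks:
  assumes "(u, v) \<in> disjoint_pairs n a b"
  shows "join_walks u v \<in> tree_walks n (Suc (a + b))"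
proof -
  have u: "u \<in> tree_walks n a" "u \<noteq> []" and v: "v \<in> tree_walks n b" "v \<noteq> []"
    and disj: "set u \<inter> set v = {}"
    using assms tree_walks_nonempty by (auto simp: disjoint_pairs_def)
  have "last u = hd u" using u by (auto simp: tree_walks_def closed_walks_def)
  then have st: "steps (join_walks u v) = edge (hd v) (hd u) # steps u @ edge (hd v) (hd u) #
      steps v"
    using u(2) v(2) by (simp add: join_walks_def steps_Cons steps_append edge_commute)
  have "2 \<le> count_list (steps (join_walks u v)) e" if "e \<in> set (steps (join_walks u v))" for e
    using that u v unfolding st by (auto simp: tree_walks_def intro: trans_le_add1 trans_le_add2)
  moreover have "set (join_walks u v) = set u \<union> set v"
    using v(2) by (auto simp: join_walks_def)
  then have "card (set (join_walks u v)) = Suc (a + b) + 1"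
    using u v disj by (simp add: card_Un_disjoint tree_walks_def)
  moreover have "hd v < n"
    using v hd_in_set[OF v(2)] unfolding tree_walks_def closed_walks_def by blast
  then have "join_walks u v \<in> closed_walks n (2 * Suc (a + b))"
    using u v by (auto simp: tree_walks_def closed_walks_def join_walks_def)
  ultimately show ?thesis by (auto simp: tree_walks_def)
qed

text \<open>First return decomposition: the edge leaving the root is a bridge, so the walk comes back
  through it.\<close>

lemma tree_walks_split:
  assumes w: "w \<in> tree_walks n (Suc m)"
  obtains a b u v where "a + b = m" "(u, v) \<in> disjoint_pairs n a b" "w = join_walks u v"
proof -
  have len: "length w = 2 * m + 3" and closed: "hd w = last w" and sub: "set w \<subseteq> {..<n}"
    and card_w: "card (set w) = m + 2"
    using w by (auto simp: tree_walks_def closed_walks_def)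
  obtain r i where wr: "w = i # r" "r \<noteq> []" 
  proof (cases w)
    case (Cons i r)
    then show ?thesis using that len by (cases r) auto
  qed (use len in simp)
  define u where "u = takeWhile (\<lambda>y. y \<noteq> i) r"
  define v where "v = dropWhile (\<lambda>y. y \<noteq> i) r"
  have r: "r = u @ v" by (simp add: u_def v_def)
  have i_u: "i \<notin> set u" by (auto simp: u_def dest: set_takeWhileD)
  have "i \<in> set r" using closed wr by (auto dest: sym)
  then have v_ne: "v \<noteq> []" by (auto simp: v_def)
  then have hd_v: "hd v = i" using hd_dropWhile[of "\<lambda>y. y \<noteq> i" r] by (simp add: v_def)
  have last_v: "last v = i" using closed wr r v_ne by (auto dest: sym)
  define j where "j = hd r"
  let ?e = "edge i j"
  let ?F = "set (steps w) - {?e}"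
  have st_w: "steps w = ?e # steps r" using wr by (simp add: steps_Cons j_def)
  have bridge: "(i, j) \<notin> (adj ?F)\<^sup>*"
    using tree_walks_not_reachable[OF w, of i j] st_w by simp
  have count: "count_list (steps w) e = 2" if "e \<in> set (steps w)" for e
    using tree_walks_count[OF w that] .
  \<comment> \<open>An empty excursion would be a loop at the root, whose ends are connected without
    it, so it cannot be a bridge.\<close>
  have u_ne: "u \<noteq> []"
  proof
    assume "u = []"
    then have "j = i" using r hd_v by (simp add: j_def)
    then show False using bridge by simp
  qed
  then have hd_u: "hd u = j" by (simp add: j_def r)
  have st_r: "steps r = steps u @ edge (last u) i # steps v"
    using u_ne v_ne hd_v by (simp add: r steps_append)
  have e_u: "?e \<notin> set (steps u)" using i_u edge_in_steps_subset by blast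
  then have u_F: "set (steps u) \<subseteq> ?F" using st_w st_r by auto
  \<comment> \<open>The excursion must close through the bridge itself; any other closing edge would
    complete a detour from \<open>j\<close> to \<open>i\<close>.\<close>
  have e': "edge (last u) i = ?e"
  proof (rule ccontr)
    assume neq: "edge (last u) i \<noteq> ?e"
    have "(j, last u) \<in> (adj ?F)\<^sup>*" using u_F u_ne hd_u walk_reachable_hd[of u ?F "last u"] by auto
    moreover have "(last u, i) \<in> adj ?F" using neq st_w st_r by (auto simp: adj_def)
    ultimately have "(j, i) \<in> (adj ?F)\<^sup>*" by (rule rtrancl_into_rtrancl)
    then show False using bridge rtrancl_adj_sym by blast
  qed
  then have last_u: "last u = hd u" using hd_u by (auto simp: edge_eq_iff)
  have st: "steps w = ?e # steps u @ ?e # steps v" using st_w st_r e' by simp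
  have "count_list (steps w) ?e = 2" by (rule count) (simp add: st)
  then have e_v: "?e \<notin> set (steps v)" using count_list_0_iff[of "steps v" ?e] by (simp add: st)
  then have v_F: "set (steps v) \<subseteq> ?F" using st by auto
  \<comment> \<open>A common vertex would join \<open>i\<close> to \<open>j\<close> along
    \<open>v\<close> and then \<open>u\<close>, again avoiding the bridge.\<close>
  have disj: "set u \<inter> set v = {}"
  proof (rule ccontr)
    assume "set u \<inter> set v \<noteq> {}"
    then obtain x where x: "x \<in> set u" "x \<in> set v" by blast
    have "(i, x) \<in> (adj ?F)\<^sup>*" using walk_reachable_hd[OF v_F x(2)] hd_v by simp
    moreover have "(x, j) \<in> (adj ?F)\<^sup>*"
      using walk_reachable_hd[OF u_F x(1)] hd_u rtrancl_adj_sym by simp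
    ultimately show False using bridge by (meson rtrancl_trans)
  qed
  have st_disj: "set (steps u) \<inter> set (steps v) = {}" by (rule steps_disjoint[OF disj])
  have count_u: "count_list (steps u) e = 2" if "e \<in> set (steps u)" for e
  proof -
    have "e \<noteq> ?e" "count_list (steps v) e = 0"
      using that e_u st_disj by (auto simp: count_list_0_iff)
    then show ?thesis using count[of e] that by (simp add: st)
  qed
  have count_v: "count_list (steps v) e = 2" if "e \<in> set (steps v)" for e
  proof -
    have "e \<noteq> ?e" "count_list (steps u) e = 0"
      using that e_v st_disj by (auto simp: count_list_0_iff)
    then show ?thesis using count[of e] that by (simp add: st)
  qed
  define a where "a = card (set (steps u))"
  define b where "b = card (set (steps v))"
  have "length (steps u) = 2 * a" "length (steps v) = 2 * b"
    using sum_count_list[of "steps u"] sum_count_list[of "steps v"] count_u count_v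
    by (simp_all add: a_def b_def)
  then have len_uv: "length u = 2 * a + 1" "length v = 2 * b + 1"
    using u_ne v_ne by (cases u; cases v; simp add: length_steps)+
  then have ab: "a + b = m" using len wr r by simp
  have "set w = set u \<union> set v" using wr r hd_v v_ne by (auto simp: hd_in_set)
  then have "card (set u) + card (set v) = m + 2" using card_w disj by (simp add: card_Un_disjoint)
  \<comment> \<open>Both bounds are attained, since together they add up to the known total
    \<open>m + 2\<close>.\<close>
  moreover have "card (set u) \<le> a + 1" "card (set v) \<le> b + 1"
    using card_set_walk_le by (auto simp: a_def b_def)
  ultimately have "card (set u) = a + 1" "card (set v) = b + 1" using ab by auto
  then have "(u, v) \<in> disjoint_pairs n a b"
    using len_uv last_u hd_v last_v count_u count_v disj sub wr r
    by (auto simp: disjoint_pairs_def tree_walks_def closed_walks_def)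
  moreover have "w = join_walks u v" by (simp add: join_walks_def wr r hd_v)
  ultimately show ?thesis using that ab by blast
qed

text \<open>First return decomposition as a bijection; the length of the excursion determines
  \<open>a\<close>, so the union over \<open>a\<close> is disjoint.\<close>

lemma card_tree_walks_Suc:
  "card (tree_walks n (Suc m)) = (\<Sum>a\<le>m. card (disjoint_pairs n a (m - a)))"
proof -
  have fin: "finite (disjoint_pairs n a b)" for a b
    by (rule finite_subset[of _ "tree_walks n a \<times> tree_walks n b"]) (auto simp: disjoint_pairs_def)
  have "tree_walks n (Suc m) = (\<lambda>(u, v). join_walks u v) ` (\<Union>a\<le>m. disjoint_pairs n a (m - a))"
  proof safe
    fix w assume "w \<in> tree_walks n (Suc m)"
    then obtain a b u v where "a + b = m" "(u, v) \<in> disjoint_pairs n a b" "w = join_walks u v"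
      by (rule tree_walks_split)
    then show "w \<in> (\<lambda>(u, v). join_walks u v) ` (\<Union>a\<le>m. disjoint_pairs n a (m - a))"
      by (intro image_eqI[of _ _ "(u, v)"]) (auto intro!: bexI[of _ a])
  next
    fix u v a assume "(u, v) \<in> disjoint_pairs n a (m - a)" "a \<le> m"
    then show "join_walks u v \<in> tree_walks n (Suc m)"
      using join_walks_tree_walks[of u v n a "m - a"] by simp
  qed
  moreover have "inj_on (\<lambda>(u, v). join_walks u v) (\<Union>a\<le>m. disjoint_pairs n a (m - a))"
    by (rule inj_on_subset[OF inj_on_join_walks]) (auto simp: disjoint_pairs_def dest:
        tree_walks_nonempty)
  ultimately have "card (tree_walks n (Suc m)) = card (\<Union>a\<le>m. disjoint_pairs n a (m - a))"
    by (simp add: card_image)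
  also have "\<dots> = (\<Sum>a\<le>m. card (disjoint_pairs n a (m - a)))"
  proof (rule card_UN_disjoint)
    show "\<forall>a\<in>{..m}. \<forall>b\<in>{..m}. a \<noteq> b \<longrightarrow> disjoint_pairs n a (m - a) \<inter> disjoint_pairs n b (m - b) = {}"
      by (auto simp: disjoint_pairs_def tree_walks_def)
  qed (use fin in auto)
  finally show ?thesis .
qed

text \<open>An intersecting pair loses a vertex: its concatenation has
  \<open>2 * (a + b) + 2\<close> letters but at most \<open>a + b + 1\<close> distinct ones. The
  prescribed lengths allow the concatenation to be cut again, so pairs are counted as words.\<close>

lemma card_nondisjoint_pairs_le:
  "card (tree_walks n a) * card (tree_walks n b) \<le>
    card (disjoint_pairs n a b) + (a + b + 1) ^ (2 * (a + b) + 2) * n ^ (a + b + 1)"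
proof -
  let ?N = "tree_walks n a \<times> tree_walks n b - disjoint_pairs n a b"
  let ?A = "{w. length w = 2 * (a + b) + 2 \<and> set w \<subseteq> {..<n} \<and> card (set w) \<le> a + b + 1}"
  have "card ?N \<le> card ?A"
  proof (rule card_inj_on_le[of "\<lambda>(u, v). u @ v"])
    show "inj_on (\<lambda>(u, v). u @ v) ?N"
      by (rule inj_onI) (auto simp: tree_walks_def closed_walks_def)
    show "(\<lambda>(u, v). u @ v) ` ?N \<subseteq> ?A"
    proof safe
      fix u v assume uv: "u \<in> tree_walks n a" "v \<in> tree_walks n b" "(u, v) \<notin> disjoint_pairs n a b"
      then have "0 < card (set u \<inter> set v)" by (auto simp: disjoint_pairs_def card_gt_0_iff)
      moreover have "card (set u) + card (set v) = card (set u \<union> set v) + card (set u \<inter> set v)"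
        by (rule card_Un_Int) auto
      ultimately show "card (set (u @ v)) \<le> a + b + 1"
        using uv by (auto simp: tree_walks_def)
    qed (auto simp: tree_walks_def closed_walks_def)
    show "finite ?A"
      by (rule finite_subset[OF _ finite_lists_length_eq[of "{..<n}" "2 * (a + b) + 2"]]) auto
  qed
  also have "\<dots> \<le> (a + b + 1) ^ (2 * (a + b) + 2) * n ^ (a + b + 1)"
    by (rule card_lists_few_values) simp
  finally have N: "card ?N \<le> (a + b + 1) ^ (2 * (a + b) + 2) * n ^ (a + b + 1)" .
  have "card (tree_walks n a \<times> tree_walks n b) \<le> card (disjoint_pairs n a b) + card ?N"
    by (rule order_trans[OF card_mono card_Un_le])
       (auto simp: disjoint_pairs_def intro: finite_subset[of _ "tree_walks n a \<times> tree_walks n b"])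
  then show ?thesis using N by (simp add: card_cartesian_product)
qed

fun catalan :: "nat \<Rightarrow> real" where
  "catalan 0 = 1"
| "catalan (Suc n) = (\<Sum>i\<le>n. catalan i * catalan (n - i))"

text \<open>Demanding disjointness changes the normalised number of pairs by O(1/n) only. In the
  limit the count of pairs factorises, and the first return decomposition becomes the Catalan
  convolution.\<close>

lemma tree_walks_asymp:
  "(\<lambda>n. real (card (tree_walks n m)) / real n ^ (m + 1)) \<longlonglongrightarrow> catalan m"
proof (induction m rule: less_induct)
  case (less m)
  show ?case
  proof (cases m)
    case 0
    have "tree_walks n 0 = (\<lambda>i. [i]) ` {..<n}" for n
      by (auto simp: tree_walks_def closed_walks_def length_Suc_conv)
    then have "card (tree_walks n 0) = n" for n by (simp add: card_image inj_on_def)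
    then show ?thesis unfolding 0
      by (intro tendsto_eventually eventually_mono[OF eventually_gt_at_top[of 0]]) auto
  next
    case (Suc m')
    let ?D = "\<lambda>a n. real (card (disjoint_pairs n a (m' - a)))"
    have D: "(\<lambda>n. ?D a n / real n ^ (m + 1)) \<longlonglongrightarrow> catalan a * catalan (m' - a)" if a: "a \<le> m'" for a
    proof -
      let ?b = "m' - a"
      let ?C = "real ((m' + 1) ^ (2 * m' + 2))"
      let ?t = "\<lambda>n. real (card (tree_walks n a)) / real n ^ (a + 1) * (real (card (tree_walks n
          ?b)) / real n ^ (?b + 1))"
      have lim: "?t \<longlonglongrightarrow> catalan a * catalan ?b"
        using a Suc by (intro tendsto_mult less) auto
      have exp: "a + 1 + (?b + 1) = m + 1" using a Suc by simp
      have t: "?t n = real (card (tree_walks n a) * card (tree_walks n ?b)) / real n ^ (m + 1)"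
          for n
        unfolding exp[symmetric] power_add by simp
      have upper: "?D a n / real n ^ (m + 1) \<le> ?t n" for n
      proof -
        have "card (disjoint_pairs n a ?b) \<le> card (tree_walks n a \<times> tree_walks n ?b)"
          by (rule card_mono) (auto simp: disjoint_pairs_def)
        then show ?thesis unfolding t card_cartesian_product
          by (intro divide_right_mono) (simp_all del: of_nat_mult)
      qed
      have lower: "?t n - ?C / real n \<le> ?D a n / real n ^ (m + 1)" if n: "n > 0" for n
      proof -
        have "card (tree_walks n a) * card (tree_walks n ?b) \<le>
            card (disjoint_pairs n a ?b) + (m' + 1) ^ (2 * m' + 2) * n ^ m"
          using card_nondisjoint_pairs_le[of n a ?b] a Suc by simp
        then have "real (card (tree_walks n a) * card (tree_walks n ?b)) \<le> ?D a n + ?C * real n ^ m"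
          by (metis of_nat_add of_nat_le_iff of_nat_mult of_nat_power)
        then have "?t n \<le> (?D a n + ?C * real n ^ m) / real n ^ (m + 1)"
          unfolding t by (rule divide_right_mono) simp
        also have "\<dots> = ?D a n / real n ^ (m + 1) + ?C / real n"
          using n by (simp add: add_divide_distrib)
        finally show ?thesis by simp
      qed
      have "(\<lambda>n. ?t n - ?C / real n) \<longlonglongrightarrow> catalan a * catalan ?b - 0"
        by (intro tendsto_diff lim lim_const_over_n)
      then have lim': "(\<lambda>n. ?t n - ?C / real n) \<longlonglongrightarrow> catalan a * catalan ?b" by simp
      show ?thesis
      proof (rule tendsto_sandwich[OF _ _ lim' lim])
        show "\<forall>\<^sub>F n in sequentially. ?t n - ?C / real n \<le> ?D a n / real n ^ (m + 1)"
          using eventually_gt_at_top[of 0] by eventually_elim (rule lower)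
        show "\<forall>\<^sub>F n in sequentially. ?D a n / real n ^ (m + 1) \<le> ?t n"
          by (intro always_eventually allI upper)
      qed
    qed
    have "(\<lambda>n. \<Sum>a\<le>m'. ?D a n / real n ^ (m + 1)) \<longlonglongrightarrow> (\<Sum>a\<le>m'. catalan a * catalan (m' - a))"
      using D by (intro tendsto_sum) auto
    then show ?thesis by (simp add: Suc card_tree_walks_Suc sum_divide_distrib)
  qed
qed

subsection \<open>Spectral moments as traces\<close>

lemma monic_eq_prod_proots:
  fixes p :: "'a :: field poly"
  assumes "lead_coeff p = 1" and "size (proots p) = degree p"
  shows "p = (\<Prod>x\<in>#proots p. [:- x, 1:])"
  using assms
proof (induction "degree p" arbitrary: p)
  case 0
  then have "p = 1" using monic_degree_0[of p] by simp
  then show ?case by simp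
next
  case (Suc d)
  then have p0: "p \<noteq> 0" by auto
  have "proots p \<noteq> {#}" using Suc.hyps(2) Suc.prems(2) by auto
  then obtain x where "x \<in># proots p" by (rule multiset_nonemptyE)
  then have "poly p x = 0" using p0 by simp
  then obtain q where q: "p = [:- x, 1:] * q" by (auto simp: poly_eq_0_iff_dvd)
  then have q0: "q \<noteq> 0" using p0 by auto
  then have roots: "proots p = {#x#} + proots q" by (simp add: q proots_mult del: mult_pCons_left)
  have "degree p = Suc (degree q)" using q0 unfolding q by (subst degree_mult_eq) auto
  moreover have "lead_coeff q = 1" using Suc.prems(1) unfolding q lead_coeff_mult by simp
  ultimately have "q = (\<Prod>x\<in>#proots q. [:- x, 1:])"
    using Suc.hyps(2) Suc.prems(2) roots by (intro Suc.hyps(1)) auto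
  then show ?case using q roots by simp
qed

text \<open>The Schur decomposition needs the characteristic polynomial split over a list. Symmetry
  gives \<open>n\<close> real roots, and a monic polynomial with as many roots as its degree
  splits.\<close>

lemma char_poly_eigenvalue_list:
  assumes A: "A \<in> carrier_mat n n" and sym: "transpose_mat A = A"
  shows "char_poly A = (\<Prod>e\<leftarrow>eigenvalue_list A. [:- e, 1:])"
proof -
  have "size (proots (char_poly A)) = n"
    using length_eigenvalue_list[OF A sym] unfolding eigenvalue_list_def
    by (metis mset_sorted_list_of_multiset size_mset)
  then have "char_poly A = (\<Prod>x\<in>#proots (char_poly A). [:- x, 1:])"
    using degree_monic_char_poly[OF A] by (intro monic_eq_prod_proots) auto
  also have "proots (char_poly A) = mset (eigenvalue_list A)" by (simp add: eigenvalue_list_def)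
  also have "(\<Prod>x\<in>#mset (eigenvalue_list A). [:- x, 1:]) = (\<Prod>e\<leftarrow>eigenvalue_list A. [:- e, 1:])"
    by (metis mset_map prod_mset_prod_list)
  finally show ?thesis .
qed

lemma mult_mat_entry:
  assumes "A \<in> carrier_mat n n" "B \<in> carrier_mat n n" "i < n" "j < n"
  shows "(A * B) $$ (i, j) = (\<Sum>l<n. A $$ (i, l) * B $$ (l, j))"
  using assms by (auto simp: scalar_prod_def lessThan_atLeast0)

lemma sum_diag_mult_commute:
  fixes A B :: "'a :: comm_semiring_0 mat"
  assumes A: "A \<in> carrier_mat n n" and B: "B \<in> carrier_mat n n"
  shows "(\<Sum>i<n. (A * B) $$ (i, i)) = (\<Sum>i<n. (B * A) $$ (i, i))"
proof -
  have "(\<Sum>i<n. (A * B) $$ (i, i)) = (\<Sum>i<n. \<Sum>l<n. A $$ (i, l) * B $$ (l, i))"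
    by (intro sum.cong refl mult_mat_entry[OF A B]) auto
  also have "\<dots> = (\<Sum>l<n. \<Sum>i<n. B $$ (l, i) * A $$ (i, l))"
    by (subst sum.swap) (simp add: mult.commute)
  also have "\<dots> = (\<Sum>i<n. (B * A) $$ (i, i))"
    by (intro sum.cong refl mult_mat_entry[OF B A, symmetric]) auto
  finally show ?thesis .
qed

lemma upper_triangular_pow:
  assumes A: "A \<in> carrier_mat n n" and up: "upper_triangular A" and i: "i < n" and j: "j \<le> i"
  shows "(A ^\<^sub>m k) $$ (i, j) = (if i = j then A $$ (i, i) ^ k else 0)"
  using i j
proof (induction k arbitrary: i j)
  case 0
  then show ?case using A by simp
next
  case (Suc k)
  have zero: "A $$ (a, b) = 0" if "b < a" "a < n" for a b
    using up A that by (auto dest: upper_triangularD)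
  have "(A ^\<^sub>m Suc k) $$ (i, j) = (\<Sum>l<n. (A ^\<^sub>m k) $$ (i, l) * A $$ (l, j))"
    using Suc.prems A by (subst pow_mat.simps, subst mult_mat_entry) auto
  \<comment> \<open>For \<open>l < i\<close> the left factor vanishes by induction; for
    \<open>l > i\<close> the right one does, because \<open>j \<le> i < l\<close>.\<close>
  also have "\<dots> = (\<Sum>l<n. if l = i then A $$ (i, i) ^ k * A $$ (i, j) else 0)"
  proof (rule sum.cong)
    fix l assume l: "l \<in> {..<n}"
    show "(A ^\<^sub>m k) $$ (i, l) * A $$ (l, j) = (if l = i then A $$ (i, i) ^ k * A $$ (i, j) else 0)"
    proof (cases "l \<le> i")
      case True
      then show ?thesis using Suc.IH[of i l] Suc.prems by auto
    next
      case False
      then show ?thesis using zero[of j l] Suc.prems l by auto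
    qed
  qed simp
  also have "\<dots> = A $$ (i, i) ^ k * A $$ (i, j)" using Suc.prems by simp
  finally show ?case using zero[of j i] Suc.prems by (auto simp: power_Suc2 simp del: power_Suc
      pow_mat.simps)
qed

text \<open>Triangularise, cancel the similarity by cyclicity of the trace, and read off the
  diagonal of a power of a triangular matrix. The decomposition keeps the order of
  \<open>eigenvalue_list\<close> on that diagonal.\<close>

lemma sum_list_eigenvalue_powers:
  assumes A: "A \<in> carrier_mat n n" and sym: "transpose_mat A = A"
  shows "(\<Sum>l<n. (eigenvalue_list A ! l) ^ k) = (\<Sum>i<n. (A ^\<^sub>m k) $$ (i, i))"
proof -
  obtain B P Q where "schur_decomposition A (eigenvalue_list A) = (B, P, Q)"
    by (metis prod_cases3)
  with schur_decomposition[OF A char_poly_eigenvalue_list[OF A sym]]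
  have sim: "similar_mat_wit A B P Q" and up: "upper_triangular B"
    and diag: "diag_mat B = eigenvalue_list A" by auto
  note w = similar_mat_witD2[OF A sim]
  have Bk: "B ^\<^sub>m k \<in> carrier_mat n n" using w by simp
  have "(\<Sum>i<n. (A ^\<^sub>m k) $$ (i, i)) = (\<Sum>i<n. (P * B ^\<^sub>m k * Q) $$ (i, i))"
    by (simp add: similar_mat_wit_pow_id[OF sim])
  also have "\<dots> = (\<Sum>i<n. (Q * (P * B ^\<^sub>m k)) $$ (i, i))"
    using w Bk by (intro sum_diag_mult_commute) auto
  also have "Q * (P * B ^\<^sub>m k) = (Q * P) * B ^\<^sub>m k"
    using w Bk by (intro assoc_mult_mat[symmetric]) auto
  also have "\<dots> = B ^\<^sub>m k" unfolding w(2) by (rule left_mult_one_mat[OF Bk])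
  also have "(\<Sum>i<n. (B ^\<^sub>m k) $$ (i, i)) = (\<Sum>l<n. (eigenvalue_list A ! l) ^ k)"
    using upper_triangular_pow[OF w(5) up] w(5) by (simp add: diag[symmetric] diag_mat_def)
  finally show ?thesis by simp
qed

text \<open>Integrals become averages over the indices once the spectral distribution is seen as an
  image of the uniform distribution.\<close>

lemma esd_eq_distr:
  assumes "0 < dim_row A"
  shows "esd A = distr (measure_pmf (pmf_of_set {..<dim_row A})) borel (\<lambda>l. eigenvalue_list A ! l)"
proof (rule measure_eqI)
  fix B assume "B \<in> sets (esd A)"
  then have B: "B \<in> sets borel" by simp
  let ?n = "dim_row A"
  have ne: "{..<?n} \<noteq> {}" using assms by auto
  have "emeasure (distr (measure_pmf (pmf_of_set {..<?n})) borel (\<lambda>l. eigenvalue_list A ! l)) B =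
      emeasure (measure_pmf (pmf_of_set {..<?n})) {l. eigenvalue_list A ! l \<in> B}"
    using B by (subst emeasure_distr) (auto simp: vimage_def)
  also have "\<dots> = (\<integral>\<^sup>+l. indicator {l. eigenvalue_list A ! l \<in> B} l \<partial>measure_pmf (pmf_of_set
      {..<?n}))"
    by (rule nn_integral_indicator[symmetric]) simp
  also have "\<dots> = (\<Sum>l<?n. indicator {l. eigenvalue_list A ! l \<in> B} l) / of_nat ?n"
    using ne by (subst nn_integral_pmf_of_set) auto
  also have "(\<Sum>l<?n. indicator {l. eigenvalue_list A ! l \<in> B} l) =
      (\<Sum>l<?n. emeasure (return borel (eigenvalue_list A ! l)) B)"
    using B by (intro sum.cong refl) (simp add: indicator_def)
  finally show "emeasure (esd A) B =
      emeasure (distr (measure_pmf (pmf_of_set {..<?n})) borel (\<lambda>l. eigenvalue_list A ! l)) B"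
    using B by (simp add: emeasure_esd)
qed simp

lemma
  fixes f :: "real \<Rightarrow> real"
  assumes n: "0 < dim_row A" and f [measurable]: "f \<in> borel_measurable borel"
  shows integrable_esd: "integrable (esd A) f"
    and integral_esd: "integral\<^sup>L (esd A) f = (\<Sum>l<dim_row A. f (eigenvalue_list A ! l)) / dim_row A"
proof -
  have ne: "{..<dim_row A} \<noteq> {}" using n by auto
  show "integrable (esd A) f"
    unfolding esd_eq_distr[OF n]
    by (subst integrable_distr_eq) (auto intro!: integrable_measure_pmf_finite simp:
        set_pmf_of_set[OF ne])
  show "integral\<^sup>L (esd A) f = (\<Sum>l<dim_row A. f (eigenvalue_list A ! l)) / dim_row A"
    unfolding esd_eq_distr[OF n] using ne by (subst integral_distr) (auto simp: integral_pmf_of_set)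
qed

text \<open>Each walk to \<open>j\<close> arises from exactly one walk to its penultimate vertex
  \<open>l\<close>. The weights sit on unoriented edges, so the products are indexed directly by the
  independent entries on and above the diagonal.\<close>

lemma pow_mat_eq_sum_walks:
  fixes a :: "nat \<times> nat \<Rightarrow> 'a :: comm_semiring_1"
  assumes A: "A \<in> carrier_mat n n" and a: "\<And>i j. i < n \<Longrightarrow> j < n \<Longrightarrow> A $$ (i, j) = a (edge i j)"
    and ij: "i < n" "j < n"
  shows "(A ^\<^sub>m k) $$ (i, j) =
    (\<Sum>w | length w = k + 1 \<and> set w \<subseteq> {..<n} \<and> hd w = i \<and> last w = j. \<Prod>e\<leftarrow>steps w. a e)"
    (is "_ = sum _ (?W k i j)")
  using ij
proof (induction k arbitrary: j)
  case 0
  have "?W 0 i j = (if i = j then {[i]} else {})"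
    using 0 by (auto simp: length_Suc_conv)
  then show ?case using 0 A by simp
next
  case (Suc k)
  have fin: "finite (?W k i l)" for l
    by (rule finite_subset[OF _ finite_lists_length_eq[of "{..<n}" "k + 1"]]) auto
  have "(A ^\<^sub>m Suc k) $$ (i, j) = (\<Sum>l<n. (A ^\<^sub>m k) $$ (i, l) * A $$ (l, j))"
    using Suc.prems A by (subst pow_mat.simps, subst mult_mat_entry) auto
  also have "\<dots> = (\<Sum>l<n. \<Sum>w\<in>?W k i l. (\<Prod>e\<leftarrow>steps w. a e) * a (edge l j))"
    using Suc by (intro sum.cong refl) (simp add: a sum_distrib_right)
  also have "\<dots> = (\<Sum>(l, w)\<in>(SIGMA l:{..<n}. ?W k i l). (\<Prod>e\<leftarrow>steps w. a e) * a (edge l j))"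
    using fin by (intro sum.Sigma) auto
  also have "\<dots> = (\<Sum>w\<in>?W (Suc k) i j. \<Prod>e\<leftarrow>steps w. a e)"
  proof (rule sum.reindex_bij_witness[of _ "\<lambda>v. (last (butlast v), butlast v)" "\<lambda>(l, w). w @ [j]"])
    fix x assume x: "x \<in> (SIGMA l:{..<n}. ?W k i l)"
    obtain l w where lw: "x = (l, w)" by (cases x)
    then have w: "w \<noteq> []" "length w = Suc k" "set w \<subseteq> {..<n}" "hd w = i" "last w = l" using x by
        auto
    show "(\<lambda>v. (last (butlast v), butlast v)) ((\<lambda>(l, w). w @ [j]) x) = x" using w lw by simp
    show "(\<lambda>(l, w). w @ [j]) x \<in> ?W (Suc k) i j" using w lw Suc.prems by simp
    show "(\<Prod>e\<leftarrow>steps ((\<lambda>(l, w). w @ [j]) x). a e) = (case x of (l, w) \<Rightarrow> (\<Prod>e\<leftarrow>steps w. a e) * a (edge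
        l j))"
      using w lw by (simp add: steps_append)
  next
    fix v assume v: "v \<in> ?W (Suc k) i j"
    then have v': "v \<noteq> []" "length v = Suc (Suc k)" "set v \<subseteq> {..<n}" "hd v = i" "last v = j" by auto
    then have vb: "v = butlast v @ [j]" by (metis append_butlast_last_id)
    show "(\<lambda>(l, w). w @ [j]) ((\<lambda>v. (last (butlast v), butlast v)) v) = v" using vb by simp
    have "butlast v \<noteq> []" using v' by (cases v) auto
    moreover from this have "hd (butlast v) = i" using vb v'(4) by (metis hd_append2)
    moreover have "set (butlast v) \<subseteq> {..<n}" using v'(3) by (meson in_set_butlastD subset_code(1))
    moreover from calculation have "last (butlast v) < n" by (meson last_in_set lessThan_iff
        subsetD)
    ultimately show "(\<lambda>v. (last (butlast v), butlast v)) v \<in> (SIGMA l:{..<n}. ?W k i l)"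
      using v' by auto
  qed
  finally show ?case .
qed

lemma sum_diag_pow_eq_sum_closed_walks:
  fixes a :: "nat \<times> nat \<Rightarrow> 'a :: comm_semiring_1"
  assumes A: "A \<in> carrier_mat n n" and a: "\<And>i j. i < n \<Longrightarrow> j < n \<Longrightarrow> A $$ (i, j) = a (edge i j)"
  shows "(\<Sum>i<n. (A ^\<^sub>m k) $$ (i, i)) = (\<Sum>w\<in>closed_walks n k. \<Prod>e\<leftarrow>steps w. a e)"
proof -
  let ?W = "\<lambda>i. {w. length w = k + 1 \<and> set w \<subseteq> {..<n} \<and> hd w = i \<and> last w = i}"
  have fin: "finite (?W l)" for l
    by (rule finite_subset[OF _ finite_closed_walks[of n k]]) (auto simp: closed_walks_def)
  have "last w < n" if "length w = Suc k" "set w \<subseteq> {..<n}" for w :: "nat list"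
    using that last_in_set[of w] by fastforce
  then have W: "closed_walks n k = (\<Union>i<n. ?W i)"
    by (auto simp: closed_walks_def)
  have "(\<Sum>i<n. (A ^\<^sub>m k) $$ (i, i)) = (\<Sum>i<n. \<Sum>w\<in>?W i. \<Prod>e\<leftarrow>steps w. a e)"
    using pow_mat_eq_sum_walks[OF A a] by (intro sum.cong) auto
  also have "\<dots> = (\<Sum>w\<in>(\<Union>i<n. ?W i). \<Prod>e\<leftarrow>steps w. a e)"
    using fin by (intro sum.UNION_disjoint[symmetric]) auto
  finally show ?thesis by (simp add: W)
qed

subsection \<open>Moments of the semicircle distribution\<close>

text \<open>With the generating function \<open>C = 1 + X C\<^sup>2\<close>, the square of \<open>1 - 2 X C\<close> is \<open>1 - 4 X\<close>;
  differentiating gives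
  a first order recursion.\<close>

lemma catalan_Suc: "(real n + 2) * catalan (Suc n) = (4 * real n + 2) * catalan n"
proof -
  define C where "C = Abs_fps catalan"
  define D where "D = 1 - 2 * (fps_X * C)"
  have nth_mult: "fps_nth (numeral k * f) n = numeral k * fps_nth f n" for k n and f :: "real fps"
    by (simp add: numeral_fps_const)
  have C: "C = 1 + fps_X * (C * C)"
  proof (rule fps_ext)
    fix n show "fps_nth C n = fps_nth (1 + fps_X * (C * C)) n"
      unfolding fps_add_nth fps_X_mult_nth
      by (cases n) (simp_all add: C_def fps_mult_nth atLeast0AtMost)
  qed
  then have XCC: "fps_X * (C * C) = C - 1" by (metis add_diff_cancel_left')
  have "D * D = 1 - 4 * (fps_X * C) + 4 * (fps_X * (fps_X * (C * C)))"
    by (simp add: D_def algebra_simps)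
  also have "\<dots> = 1 - 4 * fps_X"
    unfolding XCC by (simp add: algebra_simps)
  finally have DD: "D * D = 1 - 4 * fps_X" .
  then have "fps_deriv (D * D) = fps_deriv (1 - 4 * fps_X)" by simp
  then have "2 * (D * fps_deriv D) = - 4" by (simp add: algebra_simps numeral_fps_const)
  \<comment> \<open>A further factor \<open>D\<close> makes \<open>D * D\<close> reappear, which is
    a known polynomial; the equation becomes linear in \<open>D\<close>.\<close>
  then have "2 * (D * fps_deriv D) * D = - 4 * D" by simp
  then have "2 * (D * D * fps_deriv D) = - 4 * D" by (simp only: mult_ac)
  then have "2 * (fps_deriv D - 4 * (fps_X * fps_deriv D)) = - (4 * D)"
    unfolding DD by (simp add: algebra_simps)
  \<comment> \<open>\<open>D\<close> carries the Catalan numbers shifted by one place, so the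
    coefficient at \<open>Suc n\<close> compares \<open>catalan (Suc n)\<close> with
    \<open>catalan n\<close>.\<close>
  then have "fps_nth (2 * (fps_deriv D - 4 * (fps_X * fps_deriv D))) (Suc n) = fps_nth (- (4 * D))
      (Suc n)"
    by simp
  moreover have "fps_nth D (Suc k) = - 2 * catalan k" for k
    unfolding D_def fps_sub_nth nth_mult fps_X_mult_nth by (simp add: C_def del: catalan.simps)
  ultimately show ?thesis
    unfolding fps_neg_nth nth_mult fps_sub_nth fps_X_mult_nth fps_deriv_nth
    by (simp add: algebra_simps del: catalan.simps)
qed

text \<open>The ratio (4n + 2) / (n + 2) of the first order recursion stays below 4.\<close>

lemma catalan_le: "catalan n \<le> 4 ^ n"
proof (induction n)
  case (Suc n)
  have "0 \<le> catalan n"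
    by (induction n rule: catalan.induct) (auto intro!: sum_nonneg)
  then have "(4 * real n + 2) * catalan n \<le> (real n + 2) * (4 * catalan n)"
    by (simp add: algebra_simps)
  then have "(real n + 2) * catalan (Suc n) \<le> (real n + 2) * (4 * catalan n)"
    by (simp only: catalan_Suc)
  then have "catalan (Suc n) \<le> 4 * catalan n" by (simp del: catalan.simps)
  then show ?case using Suc by (simp del: catalan.simps)
qed simp

definition semicircle_moment :: "nat \<Rightarrow> real" where
  "semicircle_moment k = (if even k then catalan (k div 2) else 0)"

lemma semicircle_moment_rec:
  "(real k + 4) * semicircle_moment (k + 2) = 4 * (real k + 1) * semicircle_moment k"
proof (cases "even k")
  case True
  then obtain m where "k = 2 * m" by blast
  then show ?thesis using catalan_Suc[of m]
    by (simp add: semicircle_moment_def algebra_simps del: catalan.simps)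
qed (simp add: semicircle_moment_def)

section \<open>Integrals of powers against the semicircle density\<close>

lemma has_integral_semicircle_0: "((\<lambda>x. sqrt (4 - x\<^sup>2)) has_integral 2 * pi) {-2..2}"
proof -
  let ?F = "\<lambda>x. x * sqrt (4 - x\<^sup>2) / 2 + 2 * arcsin (x / 2)"
  have "((\<lambda>x. sqrt (4 - x\<^sup>2)) has_integral ?F 2 - ?F (-2)) {-2..2}"
  \<comment> \<open>The two summands of \<open>?F\<close> are not differentiable at -2 and 2, so the
    derivative is taken in the interior and only continuity is used at the ends.\<close>
  proof (rule fundamental_theorem_of_calculus_interior)
    show "continuous_on {-2..2} ?F" by (intro continuous_intros) auto
    fix x :: real assume x: "x \<in> {-2<..<2}"
    then have "0 < (2 - x) * (2 + x)" by (intro mult_pos_pos) auto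
    then have pos: "0 < 4 - x\<^sup>2" by (simp add: power2_eq_square algebra_simps)
    define s where "s = sqrt (4 - x\<^sup>2)"
    have s: "s > 0" "s\<^sup>2 = 4 - x\<^sup>2" using pos by (auto simp: s_def)
    have q: "sqrt (1 - (x / 2)\<^sup>2) = s / 2"
      using s by (intro real_sqrt_unique) (auto simp: power_divide field_simps)
    have "((\<lambda>x. sqrt (4 - x\<^sup>2)) has_real_derivative - x / s) (at x)"
      using pos s by (auto intro!: derivative_eq_intros simp: s_def[symmetric] field_simps)
    moreover have "((\<lambda>x. arcsin (x / 2)) has_real_derivative inverse (sqrt (1 - (x / 2)\<^sup>2)) * (1 /
        2)) (at x)"
      using x by (auto intro!: derivative_eq_intros)
    ultimately have "(?F has_real_derivative (1 * s + (- x / s) * x) / 2 + 2 * (inverse (s / 2) *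
        (1 / 2))) (at x)"
      unfolding q s_def by (intro derivative_intros DERIV_cdivide DERIV_cmult)
    also have "(1 * s + (- x / s) * x) / 2 + 2 * (inverse (s / 2) * (1 / 2)) = s"
      using s by (simp add: field_simps power2_eq_square)
    finally show "(?F has_vector_derivative sqrt (4 - x\<^sup>2)) (at x)"
      by (simp add: has_real_derivative_iff_has_vector_derivative s_def)
  qed simp
  then show ?thesis by simp
qed

text \<open>The function is (4 - x^2)^(3/2). It vanishes at -2 and 2 and its derivative reproduces
  the semicircle weight, so it yields moment identities without boundary terms.\<close>

lemma DERIV_semicircle_cubed:
  assumes x: "x \<in> {-2<..<2}"
  shows "((\<lambda>x. (4 - x\<^sup>2) * sqrt (4 - x\<^sup>2)) has_real_derivative - 3 * x * sqrt (4 - x\<^sup>2)) (at x)"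
proof -
  have "0 < (2 - x) * (2 + x)" using x by (intro mult_pos_pos) auto
  then have pos: "0 < 4 - x\<^sup>2" by (simp add: power2_eq_square algebra_simps)
  define s where "s = sqrt (4 - x\<^sup>2)"
  have s: "s > 0" "s\<^sup>2 = 4 - x\<^sup>2" using pos by (auto simp: s_def)
  have "((\<lambda>x. sqrt (4 - x\<^sup>2)) has_real_derivative - x / s) (at x)"
    using pos s by (auto intro!: derivative_eq_intros simp: s_def[symmetric] field_simps)
  moreover have "((\<lambda>x. 4 - x\<^sup>2) has_real_derivative - 2 * x) (at x)"
    by (auto intro!: derivative_eq_intros)
  ultimately have "((\<lambda>x. (4 - x\<^sup>2) * sqrt (4 - x\<^sup>2)) has_real_derivative - 2 * x * s + (- x / s) *
      (4 - x\<^sup>2)) (at x)"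
    unfolding s_def by (intro DERIV_mult)
  also have "- 2 * x * s + (- x / s) * (4 - x\<^sup>2) = - 3 * x * s"
    unfolding s(2)[symmetric] using s(1) by (simp add: field_simps power2_eq_square)
  finally show ?thesis by (simp add: s_def)
qed

lemma has_integral_semicircle_1: "((\<lambda>x. x * sqrt (4 - x\<^sup>2)) has_integral 0) {-2..2}"
proof -
  let ?F = "\<lambda>x. (4 - x\<^sup>2) * sqrt (4 - x\<^sup>2) / - 3 :: real"
  have "((\<lambda>x. x * sqrt (4 - x\<^sup>2)) has_integral ?F 2 - ?F (-2)) {-2..2}"
  proof (rule fundamental_theorem_of_calculus_interior)
    show "continuous_on {-2..2} ?F" by (intro continuous_intros) auto
    fix x :: real assume "x \<in> {-2<..<2}"
    from DERIV_cdivide[OF DERIV_semicircle_cubed[OF this], of "- 3"]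
    show "(?F has_vector_derivative x * sqrt (4 - x\<^sup>2)) (at x)"
      by (simp add: has_real_derivative_iff_has_vector_derivative)
  qed simp
  then show ?thesis by simp
qed

text \<open>Integrate the derivative of x^(k+1) (4 - x^2)^(3/2): the boundary terms vanish, and 4 -
  x^2 splits into the orders k and k + 2. The coefficient k + 4 is k + 1 from the power plus 3 from
  the weight.\<close>

lemma has_integral_semicircle_rec:
  assumes I: "((\<lambda>x. x ^ k * sqrt (4 - x\<^sup>2)) has_integral I) {-2..2}"
  shows "((\<lambda>x. x ^ (k + 2) * sqrt (4 - x\<^sup>2)) has_integral 4 * (real k + 1) / (real k + 4) * I)
      {-2..2}"
proof -
  let ?F = "\<lambda>x. x ^ (k + 1) * ((4 - x\<^sup>2) * sqrt (4 - x\<^sup>2)) :: real"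
  let ?f = "\<lambda>x. x ^ k * sqrt (4 - x\<^sup>2) :: real" and ?g = "\<lambda>x. x ^ (k + 2) * sqrt (4 - x\<^sup>2) :: real"
  have "((\<lambda>x. 4 * (real k + 1) * ?f x - (real k + 4) * ?g x) has_integral ?F 2 - ?F (-2)) {-2..2}"
  proof (rule fundamental_theorem_of_calculus_interior)
    show "continuous_on {-2..2} ?F" by (intro continuous_intros)
    fix x :: real assume x: "x \<in> {-2<..<2}"
    have "((\<lambda>x. x ^ (k + 1)) has_real_derivative real (k + 1) * x ^ k) (at x)"
      using DERIV_pow[of "k + 1" x] by simp
    from DERIV_mult[OF this DERIV_semicircle_cubed[OF x]]
    have "(?F has_real_derivative 4 * (real k + 1) * ?f x - (real k + 4) * ?g x) (at x)"
      by (rule DERIV_cong) (simp add: algebra_simps power2_eq_square)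
    then show "(?F has_vector_derivative 4 * (real k + 1) * ?f x - (real k + 4) * ?g x) (at x)"
      by (simp add: has_real_derivative_iff_has_vector_derivative)
  qed simp
  then have J: "((\<lambda>x. 4 * (real k + 1) * ?f x - (real k + 4) * ?g x) has_integral 0) {-2..2}" by
      simp
  have "((\<lambda>x. (4 * (real k + 1) * ?f x - (4 * (real k + 1) * ?f x - (real k + 4) * ?g x)) / (real
      k + 4))
      has_integral (4 * (real k + 1) * I - 0) / (real k + 4)) {-2..2}"
    by (intro has_integral_divide has_integral_diff has_integral_mult_right I J)
  moreover have "(\<lambda>x. (4 * (real k + 1) * ?f x - (4 * (real k + 1) * ?f x - (real k + 4) * ?g x))
      / (real k + 4)) = ?g"
    by (rule ext) (simp add: add_nonneg_eq_0_iff)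
  ultimately show ?thesis by simp
qed

lemma has_integral_semicircle_moment:
  "((\<lambda>x. x ^ k * sqrt (4 - x\<^sup>2)) has_integral 2 * pi * semicircle_moment k) {-2..2}"
proof (induction k rule: induct_nat_012)
  case 0
  then show ?case using has_integral_semicircle_0 by (simp add: semicircle_moment_def)
next
  case 1
  then show ?case using has_integral_semicircle_1 by (simp add: semicircle_moment_def)
next
  case (ge2 k)
  have "semicircle_moment (k + 2) = 4 * (real k + 1) / (real k + 4) * semicircle_moment k"
    using semicircle_moment_rec[of k] by (simp add: field_simps)
  then show ?case using has_integral_semicircle_rec[OF ge2(1)] by (simp add: mult_ac)
qed

lemma has_bochner_integral_semicircle:
  "has_bochner_integral lborel
     (\<lambda>x. 1 / (2 * pi) * sqrt (4 - x\<^sup>2) * indicator {-2..2} x * x ^ k) (semicircle_moment k)"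
proof -
  have int: "set_integrable lborel {-2..2} (\<lambda>x. x ^ k * sqrt (4 - x\<^sup>2))"
    by (intro borel_integrable_atLeastAtMost' continuous_intros)
  have "(LINT x:{-2..2}|lborel. x ^ k * sqrt (4 - x\<^sup>2)) = 2 * pi * semicircle_moment k"
    using set_borel_integral_eq_integral(2)[OF int] has_integral_semicircle_moment[of k]
    by (simp add: integral_unique)
  then have "has_bochner_integral lborel (\<lambda>x. indicator {-2..2} x *\<^sub>R (x ^ k * sqrt (4 - x\<^sup>2)))
      (2 * pi * semicircle_moment k)"
    using int unfolding set_integrable_def set_lebesgue_integral_def
    by (simp add: has_bochner_integral_iff)
  then have "has_bochner_integral lborel
      (\<lambda>x. 1 / (2 * pi) * (indicator {-2..2} x *\<^sub>R (x ^ k * sqrt (4 - x\<^sup>2))))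
      (1 / (2 * pi) * (2 * pi * semicircle_moment k))"
    by (rule has_bochner_integral_mult_right)
  moreover have "(\<lambda>x. 1 / (2 * pi) * (indicator {-2..2} x *\<^sub>R (x ^ k * sqrt (4 - x\<^sup>2)))) =
      (\<lambda>x. 1 / (2 * pi) * sqrt (4 - x\<^sup>2) * indicator {-2..2} x * x ^ k)"
    by (rule ext) (simp add: mult_ac)
  ultimately show ?thesis by simp
qed

text \<open>The real \<open>sqrt\<close> is negative at negative arguments; outside [-2,2] it is the
  indicator that prevents a negative value.\<close>

lemma semicircle_density_nonneg: "0 \<le> 1 / (2 * pi) * sqrt (4 - x\<^sup>2) * indicator {-2..2} x"
  by (cases "x \<in> {-2..2}") (auto simp: abs_le_square_iff[of x 2, symmetric, simplified])

lemma
  shows integrable_semicircle: "integrable semicircle_distribution (\<lambda>x. x ^ k)"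
    and integral_semicircle: "integral\<^sup>L semicircle_distribution (\<lambda>x. x ^ k) = semicircle_moment k"
  unfolding semicircle_distribution_def
  using has_bochner_integral_semicircle[of k] semicircle_density_nonneg
  by (subst integrable_density integral_density; simp add: has_bochner_integral_iff)+

lemma real_distribution_semicircle: "real_distribution semicircle_distribution"
proof -
  let ?g = "\<lambda>x :: real. 1 / (2 * pi) * sqrt (4 - x\<^sup>2) * indicator {-2..2} x"
  have g: "has_bochner_integral lborel ?g 1"
    using has_bochner_integral_semicircle[of 0] by (simp add: semicircle_moment_def)
  have "emeasure semicircle_distribution (space semicircle_distribution) = (\<integral>\<^sup>+x. ennreal (?g x)
      \<partial>lborel)"
    by (simp add: semicircle_distribution_def emeasure_density)
  also have "\<dots> = ennreal (integral\<^sup>L lborel ?g)"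
    using g semicircle_density_nonneg by (intro nn_integral_eq_integral) (auto simp:
        has_bochner_integral_iff)
  also have "integral\<^sup>L lborel ?g = 1" using g unfolding has_bochner_integral_iff by (rule
      conjunct2)
  finally have "emeasure semicircle_distribution (space semicircle_distribution) = 1" by simp
  then show ?thesis
    by (intro real_distribution.intro real_distribution_axioms.intro prob_spaceI)
       (auto simp: semicircle_distribution_def)
qed

subsection \<open>Convergence of moments and weak convergence\<close>

text \<open>Taylor polynomials of characteristic functions involve finitely many moments. The error
  is governed by the moment of order \<open>2 * m\<close>, which for the limit is at most
  \<open>R ^ (2 * m)\<close> and loses against the factorial; convergence of this one moment carries
  the estimate over to \<open>\<mu> n\<close> for large \<open>n\<close>.\<close>

lemma weak_conv_m_of_moments:
  assumes distr: "\<And>n. real_distribution (\<mu> n)" "real_distribution \<nu>"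
    and int: "\<And>n k. integrable (\<mu> n) (\<lambda>x. x ^ k)" "\<And>k. integrable \<nu> (\<lambda>x. x ^ k)"
    and lim: "\<And>k. (\<lambda>n. integral\<^sup>L (\<mu> n) (\<lambda>x. x ^ k)) \<longlonglongrightarrow> integral\<^sup>L \<nu> (\<lambda>x. x ^ k)"
    and bound: "\<And>m. integral\<^sup>L \<nu> (\<lambda>x. x ^ (2 * m)) \<le> R ^ (2 * m)"
  shows "weak_conv_m \<mu> \<nu>"
proof (rule levy_continuity[OF distr])
  fix t
  let ?P = "\<lambda>\<rho> m. (\<Sum>k\<le>2 * m. ((\<i> * complex_of_real t) ^ k / fact k) * complex_of_real (integral\<^sup>L
      \<rho> (\<lambda>x. x ^ k)))"
  let ?c = "\<lambda>m. 2 * \<bar>t\<bar> ^ (2 * m) / fact (2 * m)"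
  \<comment> \<open>At even order the absolute moment in the remainder is the moment itself, so its
    convergence is part of \<open>lim\<close>.\<close>
  have approx: "cmod (char \<rho> t - ?P \<rho> m) \<le> ?c m * integral\<^sup>L \<rho> (\<lambda>x. x ^ (2 * m))"
    if "real_distribution \<rho>" "\<And>k. integrable \<rho> (\<lambda>x. x ^ k)" for \<rho> m
    using real_distribution.char_approx1[OF that(1), of "2 * m" t] that(2)
    by (simp add: power_even_abs)
  show "(\<lambda>n. char (\<mu> n) t) \<longlonglongrightarrow> char \<nu> t"
  proof (rule LIMSEQ_I)
    fix e :: real assume e: "0 < e"
    have "(\<lambda>k. (\<bar>t\<bar> * R) ^ k / fact k) \<longlonglongrightarrow> 0"
      using summable_LIMSEQ_zero[OF summable_exp[of "\<bar>t\<bar> * R"]] by (simp add: field_simps)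
    then have "(\<lambda>m. (\<bar>t\<bar> * R) ^ (2 * m) / fact (2 * m)) \<longlonglongrightarrow> 0"
      by (rule LIMSEQ_subseq_LIMSEQ[unfolded o_def]) (simp add: strict_mono_def)
    then have "(\<lambda>m. 2 * ((\<bar>t\<bar> * R) ^ (2 * m) / fact (2 * m))) \<longlonglongrightarrow> 2 * 0"
      by (intro tendsto_intros)
    then have "eventually (\<lambda>m. 2 * ((\<bar>t\<bar> * R) ^ (2 * m) / fact (2 * m)) < e / 3) sequentially"
      using e by (intro order_tendstoD(2)) auto
    then obtain m where m: "2 * ((\<bar>t\<bar> * R) ^ (2 * m) / fact (2 * m)) < e / 3"
      by (auto simp: eventually_sequentially)
    have "?c m * integral\<^sup>L \<nu> (\<lambda>x. x ^ (2 * m)) \<le> ?c m * R ^ (2 * m)"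
      by (intro mult_left_mono bound) auto
    also have "\<dots> = 2 * ((\<bar>t\<bar> * R) ^ (2 * m) / fact (2 * m))" by (simp add: power_mult_distrib)
    finally have c: "?c m * integral\<^sup>L \<nu> (\<lambda>x. x ^ (2 * m)) < e / 3" using m by simp
    have "(\<lambda>n. ?c m * integral\<^sup>L (\<mu> n) (\<lambda>x. x ^ (2 * m))) \<longlonglongrightarrow> ?c m * integral\<^sup>L \<nu> (\<lambda>x. x ^ (2 * m))"
      by (intro tendsto_intros lim)
    then have ev1: "\<forall>\<^sub>F n in sequentially. ?c m * integral\<^sup>L (\<mu> n) (\<lambda>x. x ^ (2 * m)) < e / 3"
      using c by (rule order_tendstoD(2))
    have "(\<lambda>n. ?P (\<mu> n) m) \<longlonglongrightarrow> ?P \<nu> m"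
      by (intro tendsto_intros lim)
    then have ev2: "\<forall>\<^sub>F n in sequentially. cmod (?P (\<mu> n) m - ?P \<nu> m) < e / 3"
      using e tendstoD[of "\<lambda>n. ?P (\<mu> n) m" _ _ "e / 3"] by (simp add: dist_norm)
    have "\<forall>\<^sub>F n in sequentially. cmod (char (\<mu> n) t - char \<nu> t) < e"
      using ev1 ev2
    proof eventually_elim
      case (elim n)
      have "cmod (char (\<mu> n) t - char \<nu> t) \<le>
          cmod (char (\<mu> n) t - ?P (\<mu> n) m) + cmod (?P (\<mu> n) m - ?P \<nu> m) + cmod (char \<nu> t - ?P \<nu> m)"
        using norm_triangle_ineq[of "char (\<mu> n) t - ?P (\<mu> n) m" "?P (\<mu> n) m - char \<nu> t"]
          norm_triangle_ineq[of "?P (\<mu> n) m - ?P \<nu> m" "?P \<nu> m - char \<nu> t"]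
        by (simp add: norm_minus_commute)
      then show ?case
        using elim c approx[OF distr(1) int(1), of n m] approx[OF distr(2) int(2), of m] by linarith
    qed
    then show "\<exists>N. \<forall>n\<ge>N. cmod (char (\<mu> n) t - char \<nu> t) < e"
      by (simp add: eventually_sequentially)
  qed
qed

subsection \<open>Mixed moments of the entries\<close>

text \<open>A crude substitute for the Hoelder inequality: the product is at most a power of its
  largest factor, and that power is one of the summands. The constant 1 covers the empty list. Mixed
  moments thus reduce to moments of single entries.\<close>

lemma abs_prod_list_le:
  fixes ys :: "real list"
  shows "\<bar>prod_list ys\<bar> \<le> 1 + (\<Sum>y\<leftarrow>ys. \<bar>y\<bar> ^ length ys)"
proof (cases "ys = []")
  case False
  define m where "m = Max (abs ` set ys)"
  have le: "\<bar>y\<bar> \<le> m" if "y \<in> set ys" for y using that by (simp add: m_def)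
  have "m \<in> abs ` set ys" unfolding m_def using False by (intro Max_in) auto
  then obtain x where x: "x \<in> set ys" "m = \<bar>x\<bar>" by auto
  have "\<bar>prod_list zs\<bar> \<le> m ^ length zs" if "set zs \<subseteq> set ys" for zs
    using that
  proof (induction zs)
    case (Cons z zs)
    then show ?case using le[of z] by (auto simp: abs_mult intro!: mult_mono)
  qed simp
  then have "\<bar>prod_list ys\<bar> \<le> \<bar>x\<bar> ^ length ys" using x by simp
  also have "\<bar>x\<bar> ^ k \<le> (\<Sum>y\<leftarrow>zs. \<bar>y\<bar> ^ k)" if "x \<in> set zs" for zs k
    using that
  proof (induction zs)
    case (Cons z zs)
    have "0 \<le> (\<Sum>y\<leftarrow>zs. \<bar>y\<bar> ^ k)" by (intro sum_list_nonneg) auto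
    then show ?case using Cons by (auto intro: add_increasing)
  qed simp
  then have "\<bar>x\<bar> ^ length ys \<le> (\<Sum>y\<leftarrow>ys. \<bar>y\<bar> ^ length ys)" using x by blast
  finally show ?thesis by simp
qed simp

lemma sqrt_power_even: "sqrt (real n) ^ (2 * m) = real n ^ m"
  by (simp add: power_mult)

text \<open>\<open>S\<close> may be larger than the set of letters, absent ones having exponent 0.
  Products can then run over the whole index set on which independence is given.\<close>

lemma prod_list_map_eq_prod_count:
  fixes f :: "'b \<Rightarrow> 'c :: comm_monoid_mult"
  assumes "finite S" "set xs \<subseteq> S"
  shows "(\<Prod>x\<leftarrow>xs. f x) = (\<Prod>x\<in>S. f x ^ count_list xs x)"
  using assms(2)
proof (induction xs)
  case (Cons y xs)
  have "(\<Prod>x\<in>S. f x ^ count_list (y # xs) x) = (\<Prod>x\<in>S. (if x = y then f x else 1) * f x ^ count_list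
      xs x)"
    by (intro prod.cong) auto
  also have "\<dots> = f y * (\<Prod>x\<in>S. f x ^ count_list xs x)"
    using assms(1) Cons.prems by (simp add: prod.distrib)
  finally show ?case using Cons by simp
qed simp

definition triangle :: "nat \<Rightarrow> (nat \<times> nat) set" where
  "triangle n = {(i, j). i \<le> j \<and> j < n}"

lemma finite_triangle [simp]: "finite (triangle n)"
  by (rule finite_subset[of _ "{..<n} \<times> {..<n}"]) (auto simp: triangle_def)

lemma set_steps_triangle:
  assumes "set w \<subseteq> {..<n}"
  shows "set (steps w) \<subseteq> triangle n"
  using assms
proof (induction w rule: steps.induct)
  case (1 x y w)
  then show ?case by (auto simp: triangle_def edge_def)
qed auto

lemma closed_walks_triangle: "w \<in> closed_walks n k \<Longrightarrow> set (steps w) \<subseteq> triangle n"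
  by (rule set_steps_triangle) (simp add: closed_walks_def)

lemma length_steps_closed_walks: "w \<in> closed_walks n k \<Longrightarrow> length (steps w) = k"
  by (simp add: closed_walks_def length_steps)

text \<open>Monotone convergence exchanges sum and expectation, so the series of squares is almost
  surely finite and its terms tend to 0. This works for any joint law of the
  \<open>Z n\<close>.\<close>

lemma AE_tendsto_0_of_summable_second_moment:
  fixes Z :: "nat \<Rightarrow> 'a \<Rightarrow> real" and M :: "'a measure"
  assumes int: "\<And>n. integrable M (\<lambda>\<omega>. (Z n \<omega>)\<^sup>2)" and sum: "summable (\<lambda>n. integral\<^sup>L M (\<lambda>\<omega>. (Z n
      \<omega>)\<^sup>2))"
  shows "AE \<omega> in M. (\<lambda>n. Z n \<omega>) \<longlonglongrightarrow> 0"
proof -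
  have "(\<integral>\<^sup>+\<omega>. (\<Sum>n. ennreal ((Z n \<omega>)\<^sup>2)) \<partial>M) = (\<Sum>n. \<integral>\<^sup>+\<omega>. ennreal ((Z n \<omega>)\<^sup>2) \<partial>M)"
    using int by (intro nn_integral_suminf) auto
  also have "\<dots> = (\<Sum>n. ennreal (integral\<^sup>L M (\<lambda>\<omega>. (Z n \<omega>)\<^sup>2)))"
    using int by (intro suminf_cong nn_integral_eq_integral) auto
  also have "\<dots> = ennreal (\<Sum>n. integral\<^sup>L M (\<lambda>\<omega>. (Z n \<omega>)\<^sup>2))"
    using sum by (intro suminf_ennreal2) auto
  finally have "(\<integral>\<^sup>+\<omega>. (\<Sum>n. ennreal ((Z n \<omega>)\<^sup>2)) \<partial>M) \<noteq> \<infinity>" by simp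
  then have "AE \<omega> in M. (\<Sum>n. ennreal ((Z n \<omega>)\<^sup>2)) \<noteq> \<infinity>"
    using int by (intro nn_integral_PInf_AE) auto
  then show ?thesis
  proof (rule AE_mp, intro AE_I2 impI)
    fix \<omega> assume "(\<Sum>n. ennreal ((Z n \<omega>)\<^sup>2)) \<noteq> \<infinity>"
    then have "summable (\<lambda>n. (Z n \<omega>)\<^sup>2)" by (intro summable_suminf_not_top) auto
    then have "(\<lambda>n. (Z n \<omega>)\<^sup>2) \<longlonglongrightarrow> 0" by (rule summable_LIMSEQ_zero)
    then have "(\<lambda>n. sqrt ((Z n \<omega>)\<^sup>2)) \<longlonglongrightarrow> sqrt 0" by (rule tendsto_real_sqrt)
    then show "(\<lambda>n. Z n \<omega>) \<longlonglongrightarrow> 0" by (simp add: tendsto_rabs_zero_iff)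
  qed
qed

context wigner_scheme
begin

definition edge_product :: "nat \<Rightarrow> (nat \<times> nat) list \<Rightarrow> 'a \<Rightarrow> real" where
  "edge_product n xs \<omega> = (\<Prod>e\<leftarrow>xs. X n (fst e) (snd e) \<omega>)"

lemma edge_product_append: "edge_product n (xs @ ys) \<omega> = edge_product n xs \<omega> * edge_product n ys \<omega>"
  by (simp add: edge_product_def)

lemma measurable_entry: "e \<in> triangle n \<Longrightarrow> X n (fst e) (snd e) \<in> borel_measurable M"
  by (auto simp: triangle_def intro: random_variable_entries)

lemma measurable_edge_product:
  "set xs \<subseteq> triangle n \<Longrightarrow> edge_product n xs \<in> borel_measurable M"
proof (induction xs)
  case (Cons e xs)
  then have "(\<lambda>\<omega>. X n (fst e) (snd e) \<omega> * edge_product n xs \<omega>) \<in> borel_measurable M"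
    by (intro borel_measurable_times measurable_entry) auto
  then show ?case by (simp add: edge_product_def)
next
  case Nil
  have "edge_product n [] = (\<lambda>_. 1)" by (rule ext) (simp add: edge_product_def)
  then show ?case by simp
qed

lemma integrable_entry_abs_power:
  "e \<in> triangle n \<Longrightarrow> integrable M (\<lambda>\<omega>. \<bar>X n (fst e) (snd e) \<omega>\<bar> ^ q)"
  using moments[of q] by (auto simp: triangle_def)

lemma integrable_entry_power:
  assumes e: "e \<in> triangle n"
  shows "integrable M (\<lambda>\<omega>. X n (fst e) (snd e) \<omega> ^ q)"
proof (rule integrable_norm_cancel)
  show "integrable M (\<lambda>\<omega>. norm (X n (fst e) (snd e) \<omega> ^ q))"
    using integrable_entry_abs_power[OF e] by (simp add: power_abs)
  show "(\<lambda>\<omega>. X n (fst e) (snd e) \<omega> ^ q) \<in> borel_measurable M"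
    using measurable_entry[OF e] by (rule borel_measurable_power)
qed

lemma integrable_edge_product:
  assumes xs: "set xs \<subseteq> triangle n"
  shows "integrable M (edge_product n xs)"
proof (rule Bochner_Integration.integrable_bound)
  have sum: "integrable M (\<lambda>\<omega>. \<Sum>e\<leftarrow>zs. \<bar>X n (fst e) (snd e) \<omega>\<bar> ^ q)" if "set zs \<subseteq> triangle n" for
      zs q
    using that by (induction zs) (auto intro!: Bochner_Integration.integrable_add
        integrable_entry_abs_power)
  show "integrable M (\<lambda>\<omega>. 1 + (\<Sum>e\<leftarrow>xs. \<bar>X n (fst e) (snd e) \<omega>\<bar> ^ length xs))"
    using sum[OF xs] by (intro Bochner_Integration.integrable_add) auto
  show "edge_product n xs \<in> borel_measurable M" by (rule measurable_edge_product[OF xs])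
  show "AE \<omega> in M. norm (edge_product n xs \<omega>) \<le>
      norm (1 + (\<Sum>e\<leftarrow>xs. \<bar>X n (fst e) (snd e) \<omega>\<bar> ^ length xs))"
  proof (rule AE_I2)
    fix \<omega>
    have "\<bar>edge_product n xs \<omega>\<bar> \<le> 1 + (\<Sum>e\<leftarrow>xs. \<bar>X n (fst e) (snd e) \<omega>\<bar> ^ length xs)"
      using abs_prod_list_le[of "map (\<lambda>e. X n (fst e) (snd e) \<omega>) xs"]
      by (simp add: edge_product_def o_def)
    then show "norm (edge_product n xs \<omega>) \<le>
        norm (1 + (\<Sum>e\<leftarrow>xs. \<bar>X n (fst e) (snd e) \<omega>\<bar> ^ length xs))" by simp
  qed
qed

text \<open>The bound depends on the length alone; this uniformity turns counts of walks into
  estimates of sums of expectations.\<close>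

lemma expectation_edge_product_bounded:
  obtains B where "B \<ge> 0"
    "\<And>n xs. set xs \<subseteq> triangle n \<Longrightarrow> length xs = k \<Longrightarrow> \<bar>expectation (edge_product n xs)\<bar> \<le> B"
proof -
  obtain L where L: "L > 0" "\<And>n i j. i < n \<Longrightarrow> j < n \<Longrightarrow> expectation (\<lambda>\<omega>. \<bar>X n i j \<omega>\<bar> ^ k) \<le> L"
    using moments[of k] by blast
  show ?thesis
  \<comment> \<open>The 1 is the constant of \<open>abs_prod_list_le\<close>, and each of the
    \<open>k\<close> factors adds one \<open>L\<close>.\<close>
  proof (rule that[of "1 + real k * L"])
    show "0 \<le> 1 + real k * L" using L(1) by simp
    fix n and xs :: "(nat \<times> nat) list" assume xs: "set xs \<subseteq> triangle n" and k: "length xs = k"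
    have sum: "integrable M (\<lambda>\<omega>. \<Sum>e\<leftarrow>zs. \<bar>X n (fst e) (snd e) \<omega>\<bar> ^ k) \<and>
        expectation (\<lambda>\<omega>. \<Sum>e\<leftarrow>zs. \<bar>X n (fst e) (snd e) \<omega>\<bar> ^ k) \<le> real (length zs) * L"
      if "set zs \<subseteq> triangle n" for zs
      using that
    proof (induction zs)
      case (Cons z zs)
      have z: "integrable M (\<lambda>\<omega>. \<bar>X n (fst z) (snd z) \<omega>\<bar> ^ k)"
        using Cons.prems by (intro integrable_entry_abs_power) auto
      have "expectation (\<lambda>\<omega>. \<bar>X n (fst z) (snd z) \<omega>\<bar> ^ k) \<le> L"
        using Cons.prems by (intro L(2)) (auto simp: triangle_def)
      then show ?case using Cons z
        by (auto simp: distrib_right Bochner_Integration.integral_add intro!: add_mono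
            Bochner_Integration.integrable_add)
    qed simp
    have "\<bar>expectation (edge_product n xs)\<bar> \<le> expectation (\<lambda>\<omega>. \<bar>edge_product n xs \<omega>\<bar>)"
      by (rule integral_abs_bound)
    also have "\<dots> \<le> expectation (\<lambda>\<omega>. 1 + (\<Sum>e\<leftarrow>xs. \<bar>X n (fst e) (snd e) \<omega>\<bar> ^ k))"
    proof (rule integral_mono)
      show "integrable M (\<lambda>\<omega>. \<bar>edge_product n xs \<omega>\<bar>)"
        using integrable_edge_product[OF xs] by (rule integrable_abs)
      show "integrable M (\<lambda>\<omega>. 1 + (\<Sum>e\<leftarrow>xs. \<bar>X n (fst e) (snd e) \<omega>\<bar> ^ k))"
        using sum[OF xs] by (intro Bochner_Integration.integrable_add) auto
      show "\<bar>edge_product n xs \<omega>\<bar> \<le> 1 + (\<Sum>e\<leftarrow>xs. \<bar>X n (fst e) (snd e) \<omega>\<bar> ^ k)" for \<omega>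
        using abs_prod_list_le[of "map (\<lambda>e. X n (fst e) (snd e) \<omega>) xs"]
        by (simp add: edge_product_def o_def k)
    qed
    also have "\<dots> = 1 + expectation (\<lambda>\<omega>. \<Sum>e\<leftarrow>xs. \<bar>X n (fst e) (snd e) \<omega>\<bar> ^ k)"
      using sum[OF xs] by (subst Bochner_Integration.integral_add) (auto simp: prob_space)
    also have "\<dots> \<le> 1 + real k * L" using sum[OF xs] k by simp
    finally show "\<bar>expectation (edge_product n xs)\<bar> \<le> 1 + real k * L" .
  qed
qed

text \<open>Collecting equal factors leaves powers of distinct entries, which are independent; an
  edge absent from the list contributes the expectation of 1.\<close>

lemma expectation_edge_product:
  assumes xs: "set xs \<subseteq> triangle n"
  shows "expectation (edge_product n xs) =
    (\<Prod>e\<in>triangle n. expectation (\<lambda>\<omega>. X n (fst e) (snd e) \<omega> ^ count_list xs e))"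
proof -
  have "indep_vars (\<lambda>_. borel) (\<lambda>e \<omega>. ((\<lambda>(i, j). X n i j) e \<omega>) ^ count_list xs e) (triangle n)"
    using independent_entries[of n] unfolding triangle_def
    by (rule indep_vars_compose2) measurable
  then have ind: "indep_vars (\<lambda>_. borel) (\<lambda>e \<omega>. X n (fst e) (snd e) \<omega> ^ count_list xs e) (triangle
      n)"
    by (simp add: case_prod_beta)
  have "edge_product n xs = (\<lambda>\<omega>. \<Prod>e\<in>triangle n. X n (fst e) (snd e) \<omega> ^ count_list xs e)"
    unfolding edge_product_def by (rule ext) (rule prod_list_map_eq_prod_count[OF finite_triangle
        xs])
  then show ?thesis
    using indep_vars_lebesgue_integral[OF finite_triangle ind] integrable_entry_power by simp
qed

lemma expectation_edge_product_eq_0: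
  assumes xs: "set xs \<subseteq> triangle n" and e: "count_list xs e = 1"
  shows "expectation (edge_product n xs) = 0"
proof -
  have "e \<in> set xs" using e count_list_0_iff[of xs e] by auto
  then have et: "e \<in> triangle n" using xs by auto
  moreover from this have "expectation (\<lambda>\<omega>. X n (fst e) (snd e) \<omega> ^ count_list xs e) = 0"
    using centered[of "fst e" n "snd e"] by (auto simp: e triangle_def)
  ultimately show ?thesis
    unfolding expectation_edge_product[OF xs] by (intro prod_zero) auto
qed

lemma expectation_edge_product_eq_1:
  assumes xs: "set xs \<subseteq> triangle n" and two: "\<And>e. e \<in> set xs \<Longrightarrow> count_list xs e = 2"
  shows "expectation (edge_product n xs) = 1"
  unfolding expectation_edge_product[OF xs]
proof (rule prod.neutral, rule ballI)
  fix e assume e: "e \<in> triangle n"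
  show "expectation (\<lambda>\<omega>. X n (fst e) (snd e) \<omega> ^ count_list xs e) = 1"
  proof (cases "e \<in> set xs")
    case True
    then show ?thesis
      using two e unit_variance[of "fst e" n "snd e"] centered[of "fst e" n "snd e"] by (auto
          simp: triangle_def)
  next
    case False
    then show ?thesis by (simp add: count_list_0_iff[THEN iffD2] prob_space)
  qed
qed

lemma expectation_edge_product_append:
  assumes xs: "set xs \<subseteq> triangle n" and ys: "set ys \<subseteq> triangle n" and disj: "set xs \<inter> set ys = {}"
  shows "expectation (edge_product n (xs @ ys)) =
    expectation (edge_product n xs) * expectation (edge_product n ys)"
proof -
  have "expectation (\<lambda>\<omega>. X n (fst e) (snd e) \<omega> ^ count_list (xs @ ys) e) =
      expectation (\<lambda>\<omega>. X n (fst e) (snd e) \<omega> ^ count_list xs e) *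
      expectation (\<lambda>\<omega>. X n (fst e) (snd e) \<omega> ^ count_list ys e)" for e
  proof -
    have "count_list xs e = 0 \<or> count_list ys e = 0"
      using disj by (auto simp: count_list_0_iff)
    then show ?thesis by (auto simp: prob_space)
  qed
  then show ?thesis
    using xs ys by (simp add: expectation_edge_product prod.distrib del: count_list_append)
qed

text \<open>A single passage through some edge would make the expectation vanish. So every edge is
  repeated, there are at most k/2 edges, and connectedness allows k/2 + 1 vertices.\<close>

lemma expectation_closed_walk:
  assumes w: "w \<in> closed_walks n k" and ne: "expectation (edge_product n (steps w)) \<noteq> 0"
  shows "2 * card (set w) \<le> k + 2" and "\<And>e. e \<in> set (steps w) \<Longrightarrow> 2 \<le> count_list (steps w) e"
proof -
  show ge: "2 \<le> count_list (steps w) e" if "e \<in> set (steps w)" for e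
  proof (rule ccontr)
    assume "\<not> 2 \<le> count_list (steps w) e"
    moreover have "count_list (steps w) e \<noteq> 0" using that by (simp add: count_list_0_iff)
    ultimately have "count_list (steps w) e = 1" by simp
    then show False using ne expectation_edge_product_eq_0[OF closed_walks_triangle[OF w]] by blast
  qed
  show "2 * card (set w) \<le> k + 2"
    using card_set_le_of_count_ge_2[OF ge] card_set_walk_le[of w] length_steps_closed_walks[OF w]
        by linarith
qed

subsection \<open>Expectation and variance of the traces\<close>

definition trace_power :: "nat \<Rightarrow> nat \<Rightarrow> 'a \<Rightarrow> real" where
  "trace_power n k \<omega> = (\<Sum>w\<in>closed_walks n k. edge_product n (steps w) \<omega>)"

lemma integrable_walk: "w \<in> closed_walks n k \<Longrightarrow> integrable M (edge_product n (steps w))"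
  by (intro integrable_edge_product closed_walks_triangle)

lemma expectation_trace_power:
  "expectation (trace_power n k) = (\<Sum>w\<in>closed_walks n k. expectation (edge_product n (steps w)))"
  unfolding trace_power_def by (rule Bochner_Integration.integral_sum) (rule integrable_walk)

lemma card_closed_walks_few_values:
  "real (card {w \<in> closed_walks n k. card (set w) \<le> v}) \<le> real v ^ (k + 1) * real n ^ v"
proof -
  have "card {w \<in> closed_walks n k. card (set w) \<le> v} \<le>
      card {w. length w = k + 1 \<and> set w \<subseteq> {..<n} \<and> card (set w) \<le> v}"
    by (intro card_mono finite_subset[OF _ finite_lists_length_eq[of "{..<n}" "k + 1"]])
       (auto simp: closed_walks_def)
  also have "\<dots> \<le> v ^ (k + 1) * n ^ v" by (rule card_lists_few_values) simp
  finally show ?thesis by (metis of_nat_le_iff of_nat_mult of_nat_power)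
qed

text \<open>For \<open>k = 2 * m + 1\<close> integrality lowers the vertex bound k/2 + 1 to
  \<open>m + 1\<close>, half a power of \<open>n\<close> below the normalisation, which leaves a
  decay of order 1 / sqrt n.\<close>

lemma expectation_trace_power_odd:
  assumes k: "odd k"
  shows "(\<lambda>n. expectation (trace_power n k) / sqrt (real n) ^ (k + 2)) \<longlonglongrightarrow> 0"
proof -
  obtain m where m: "k = 2 * m + 1" using k by (rule oddE)
  obtain B where B: "B \<ge> 0"
    "\<And>n xs. set xs \<subseteq> triangle n \<Longrightarrow> length xs = k \<Longrightarrow> \<bar>expectation (edge_product n xs)\<bar> \<le> B"
    using expectation_edge_product_bounded[of k] by blast
  let ?C = "B * real (m + 1) ^ (k + 1)"
  have bound: "\<bar>expectation (trace_power n k)\<bar> \<le> ?C * real n ^ (m + 1)" for n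
  proof -
    have "\<bar>expectation (trace_power n k)\<bar> \<le>
        (\<Sum>w\<in>closed_walks n k. \<bar>expectation (edge_product n (steps w))\<bar>)"
      unfolding expectation_trace_power by (rule sum_abs)
    also have "\<dots> \<le> (\<Sum>w\<in>closed_walks n k. if card (set w) \<le> m + 1 then B else 0)"
    proof (rule sum_mono)
      fix w assume w: "w \<in> closed_walks n k"
      show "\<bar>expectation (edge_product n (steps w))\<bar> \<le> (if card (set w) \<le> m + 1 then B else 0)"
        using expectation_closed_walk(1)[OF w] B(2)[OF closed_walks_triangle[OF w]
            length_steps_closed_walks[OF w]]
        by (cases "expectation (edge_product n (steps w)) = 0") (use B(1) m in auto)
    qed
    also have "\<dots> = B * real (card {w \<in> closed_walks n k. card (set w) \<le> m + 1})"
      by (simp add: sum.If_cases Int_def)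
    also have "\<dots> \<le> B * (real (m + 1) ^ (k + 1) * real n ^ (m + 1))"
      by (intro mult_left_mono card_closed_walks_few_values B(1))
    finally show ?thesis by (simp add: mult.assoc)
  qed
  have "norm (expectation (trace_power n k) / sqrt (real n) ^ (k + 2)) \<le> ?C / sqrt (real n)" if n:
      "n > 0" for n
  proof -
    have "k + 2 = Suc (2 * (m + 1))" using m by simp
    then have s: "sqrt (real n) ^ (k + 2) = sqrt (real n) * real n ^ (m + 1)"
      by (simp only: power_Suc sqrt_power_even)
    have "\<bar>expectation (trace_power n k)\<bar> / sqrt (real n) ^ (k + 2) \<le> ?C * real n ^ (m + 1) / sqrt
        (real n) ^ (k + 2)"
      by (intro divide_right_mono bound) simp
    also have "\<dots> = ?C / sqrt (real n)" using n unfolding s by simp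
    finally show ?thesis by (simp add: abs_divide)
  qed
  then have "\<forall>\<^sub>F n in sequentially. norm (expectation (trace_power n k) / sqrt (real n) ^ (k + 2))
      \<le> ?C / sqrt (real n)"
    by (rule eventually_mono[OF eventually_gt_at_top[of 0]])
  moreover have "(\<lambda>n. ?C / sqrt (real n)) \<longlonglongrightarrow> 0"
    by (intro tendsto_divide_0[OF tendsto_const] filterlim_at_top_imp_at_infinity
        filterlim_compose[OF sqrt_at_top filterlim_real_sequentially])
  ultimately show ?thesis by (rule Lim_null_comparison)
qed

text \<open>Each tree walk contributes exactly 1. Any other closed walk with nonzero expectation has
  at most \<open>m\<close> vertices, so these together are of order n^m and vanish against
  n^(m+1).\<close>

lemma expectation_trace_power_even:
  "(\<lambda>n. expectation (trace_power n (2 * m)) / real n ^ (m + 1)) \<longlonglongrightarrow> catalan m"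
proof -
  let ?k = "2 * m"
  obtain B where B: "B \<ge> 0"
    "\<And>n xs. set xs \<subseteq> triangle n \<Longrightarrow> length xs = ?k \<Longrightarrow> \<bar>expectation (edge_product n xs)\<bar> \<le> B"
    using expectation_edge_product_bounded[of ?k] by blast
  let ?C = "B * real m ^ (?k + 1)"
  have bound: "\<bar>expectation (trace_power n ?k) - real (card (tree_walks n m))\<bar> \<le> ?C * real n ^ m"
      for n
  proof -
    have "real (card (tree_walks n m)) = (\<Sum>w\<in>closed_walks n ?k. if w \<in> tree_walks n m then 1 else
        0)"
      by (simp add: sum.If_cases Int_def tree_walks_def)
    then have "\<bar>expectation (trace_power n ?k) - real (card (tree_walks n m))\<bar> =
        \<bar>\<Sum>w\<in>closed_walks n ?k. expectation (edge_product n (steps w)) - (if w \<in> tree_walks n m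
            then 1 else 0)\<bar>"
      by (simp add: expectation_trace_power sum_subtractf)
    also have "\<dots> \<le> (\<Sum>w\<in>closed_walks n ?k.
        \<bar>expectation (edge_product n (steps w)) - (if w \<in> tree_walks n m then 1 else 0)\<bar>)"
      by (rule sum_abs)
    also have "\<dots> \<le> (\<Sum>w\<in>closed_walks n ?k. if card (set w) \<le> m then B else 0)"
    proof (rule sum_mono)
      fix w assume w: "w \<in> closed_walks n ?k"
      show "\<bar>expectation (edge_product n (steps w)) - (if w \<in> tree_walks n m then 1 else 0)\<bar> \<le>
          (if card (set w) \<le> m then B else 0)"
      proof (cases "w \<in> tree_walks n m")
        case True
        then have "expectation (edge_product n (steps w)) = 1"
          by (intro expectation_edge_product_eq_1 closed_walks_triangle[OF w] tree_walks_count)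
        then show ?thesis using True B(1) by simp
      next
        case False
        have "card (set w) \<le> m" if ne: "expectation (edge_product n (steps w)) \<noteq> 0"
        proof -
          have "card (set w) \<noteq> m + 1"
            using False w expectation_closed_walk(2)[OF w ne] by (auto simp: tree_walks_def)
          then show ?thesis using expectation_closed_walk(1)[OF w ne] by simp
        qed
        then show ?thesis
          using False B(1) B(2)[OF closed_walks_triangle[OF w] length_steps_closed_walks[OF w]] by
              auto
      qed
    qed
    also have "\<dots> = B * real (card {w \<in> closed_walks n ?k. card (set w) \<le> m})"
      by (simp add: sum.If_cases Int_def)
    also have "\<dots> \<le> B * (real m ^ (?k + 1) * real n ^ m)"
      by (intro mult_left_mono card_closed_walks_few_values B(1))
    finally show ?thesis by (simp add: mult.assoc)
  qed
  have "norm ((expectation (trace_power n ?k) - real (card (tree_walks n m))) / real n ^ (m + 1))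
      \<le> ?C / real n"
    if n: "n > 0" for n
  proof -
    have "\<bar>expectation (trace_power n ?k) - real (card (tree_walks n m))\<bar> / real n ^ (m + 1) \<le>
        ?C * real n ^ m / real n ^ (m + 1)"
      by (intro divide_right_mono bound) simp
    also have "\<dots> = ?C / real n" using n by simp
    finally show ?thesis by (simp add: abs_divide)
  qed
  then have "\<forall>\<^sub>F n in sequentially.
      norm ((expectation (trace_power n ?k) - real (card (tree_walks n m))) / real n ^ (m + 1)) \<le>
          ?C / real n"
    by (rule eventually_mono[OF eventually_gt_at_top[of 0]])
  then have "(\<lambda>n. (expectation (trace_power n ?k) - real (card (tree_walks n m))) / real n ^ (m +
      1)) \<longlonglongrightarrow> 0"
    using lim_const_over_n by (rule Lim_null_comparison)
  from tendsto_add[OF this tree_walks_asymp[of m]] show ?thesis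
    by (simp add: diff_divide_distrib)
qed

lemma expectation_trace_power_tendsto:
  "(\<lambda>n. expectation (trace_power n k) / sqrt (real n) ^ (k + 2)) \<longlonglongrightarrow> semicircle_moment k"
proof (cases "even k")
  case True
  then obtain m where m: "k = 2 * m" by blast
  then have "k + 2 = 2 * (m + 1)" by simp
  then have "sqrt (real n) ^ (k + 2) = real n ^ (m + 1)" for n by (simp only: sqrt_power_even)
  then show ?thesis
    using expectation_trace_power_even[of m] m by (simp add: semicircle_moment_def del: power_Suc
        power_Suc2)
next
  case False
  then show ?thesis using expectation_trace_power_odd by (simp add: semicircle_moment_def)
qed

text \<open>Without a common edge the two products are uncorrelated by independence. An edge used
  once in total annihilates the joint expectation and one of the single ones, so the covariance is 0
  again. The remaining pairs fall under \<open>card_two_closed_walks\<close>.\<close>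

lemma covariance_walks:
  assumes w: "w \<in> closed_walks n k" and u: "u \<in> closed_walks n k"
    and ne: "expectation (edge_product n (steps w @ steps u)) \<noteq>
      expectation (edge_product n (steps w)) * expectation (edge_product n (steps u))"
  shows "card (set (w @ u)) \<le> k"
proof (rule card_two_closed_walks)
  note tri = closed_walks_triangle[OF w] closed_walks_triangle[OF u]
  show common: "set (steps w) \<inter> set (steps u) \<noteq> {}"
    using expectation_edge_product_append[OF tri] ne by blast
  fix e assume e: "e \<in> set (steps w @ steps u)"
  show "2 \<le> count_list (steps w @ steps u) e"
  proof (rule ccontr)
    assume "\<not> 2 \<le> count_list (steps w @ steps u) e"
    moreover have "count_list (steps w @ steps u) e \<noteq> 0"
      using e count_list_0_iff by metis
    ultimately have one: "count_list (steps w @ steps u) e = 1" by linarith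
    then have "expectation (edge_product n (steps w @ steps u)) = 0"
      using tri by (intro expectation_edge_product_eq_0) auto
    moreover have "count_list (steps w) e = 1 \<or> count_list (steps u) e = 1"
      using one by auto
    then have "expectation (edge_product n (steps w)) = 0 \<or> expectation (edge_product n (steps u))
        = 0"
      using tri expectation_edge_product_eq_0 by blast
    ultimately show False using ne by auto
  qed
qed (use w u in \<open>auto simp: closed_walks_def length_steps\<close>)

text \<open>The variance is a sum of covariances over pairs of walks. Those that do not vanish visit
  at most \<open>k\<close> vertices jointly, so there are O(n^k) of them, each bounded by a
  constant.\<close>

lemma trace_power_variance:
  obtains C where "\<And>n. integrable M (\<lambda>\<omega>. (trace_power n k \<omega> - expectation (trace_power n k))\<^sup>2)"
    "\<And>n. expectation (\<lambda>\<omega>. (trace_power n k \<omega> - expectation (trace_power n k))\<^sup>2) \<le> C * real n ^ k"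
proof -
  obtain B where B: "B \<ge> 0"
    "\<And>n xs. set xs \<subseteq> triangle n \<Longrightarrow> length xs = k \<Longrightarrow> \<bar>expectation (edge_product n xs)\<bar> \<le> B"
    using expectation_edge_product_bounded[of k] by blast
  \<comment> \<open>Two concatenated walks give products of \<open>2 * k\<close> entries, which need
    their own bound.\<close>
  obtain B' where B': "B' \<ge> 0"
    "\<And>n xs. set xs \<subseteq> triangle n \<Longrightarrow> length xs = 2 * k \<Longrightarrow> \<bar>expectation (edge_product n xs)\<bar> \<le> B'"
    using expectation_edge_product_bounded[of "2 * k"] by blast
  have "integrable M (\<lambda>\<omega>. (trace_power n k \<omega> - expectation (trace_power n k))\<^sup>2) \<and>
    expectation (\<lambda>\<omega>. (trace_power n k \<omega> - expectation (trace_power n k))\<^sup>2) \<le>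
      ((B' + B * B) * real k ^ (2 * k + 2)) * real n ^ k" for n
  proof -
    let ?W = "closed_walks n k"
    let ?Y = "\<lambda>w. edge_product n (steps w)" let ?E = "\<lambda>w. expectation (edge_product n (steps w))"
    define Z where "Z w u \<omega> = (?Y w \<omega> - ?E w) * (?Y u \<omega> - ?E u)" for w u \<omega>
    have sq: "(\<lambda>\<omega>. (trace_power n k \<omega> - expectation (trace_power n k))\<^sup>2) = (\<lambda>\<omega>. \<Sum>w\<in>?W. \<Sum>u\<in>?W. Z w
        u \<omega>)"
      unfolding expectation_trace_power trace_power_def Z_def power2_eq_square
      by (simp add: sum_subtractf[symmetric] sum_product)
    have Z: "integrable M (Z w u)"
        "expectation (Z w u) = expectation (edge_product n (steps w @ steps u)) - ?E w * ?E u"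
      if w: "w \<in> ?W" and u: "u \<in> ?W" for w u
    proof -
      have Z_eq: "Z w u = (\<lambda>\<omega>. edge_product n (steps w @ steps u) \<omega> - ?E u * ?Y w \<omega> - ?E w * ?Y u
          \<omega> + ?E w * ?E u)"
        by (rule ext) (simp add: Z_def edge_product_append algebra_simps)
      have int: "integrable M (edge_product n (steps w @ steps u))" "integrable M (?Y w)"
          "integrable M (?Y u)"
        using closed_walks_triangle[OF w] closed_walks_triangle[OF u] by (auto intro!:
            integrable_edge_product)
      show "integrable M (Z w u)" unfolding Z_eq using int by simp
      show "expectation (Z w u) = expectation (edge_product n (steps w @ steps u)) - ?E w * ?E u"
        unfolding Z_eq using int by (simp add: prob_space)
    qed
    have Z_le: "expectation (Z w u) \<le> (if card (set (w @ u)) \<le> k then B' + B * B else 0)"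
      if w: "w \<in> ?W" and u: "u \<in> ?W" for w u
    proof (cases "card (set (w @ u)) \<le> k")
      case True
      have "\<bar>expectation (edge_product n (steps w @ steps u))\<bar> \<le> B'"
        using closed_walks_triangle[OF w] closed_walks_triangle[OF u]
          length_steps_closed_walks[OF w] length_steps_closed_walks[OF u] by (intro B'(2)) auto
      moreover have "\<bar>?E w * ?E u\<bar> \<le> B * B"
        unfolding abs_mult using w u B(1)
        by (intro mult_mono B(2) closed_walks_triangle length_steps_closed_walks) auto
      ultimately show ?thesis using True by (simp add: Z(2)[OF w u])
    next
      case False
      then have "expectation (edge_product n (steps w @ steps u)) = ?E w * ?E u"
        using covariance_walks[OF w u] by blast
      then show ?thesis using False by (simp add: Z(2)[OF w u])
    qed
    let ?P = "{(w, u) \<in> ?W \<times> ?W. card (set (w @ u)) \<le> k}"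
    let ?A = "{w. length w = 2 * k + 2 \<and> set w \<subseteq> {..<n} \<and> card (set w) \<le> k}"
    have "card ?P \<le> card ?A"
    proof (rule card_inj_on_le[of "\<lambda>(u, v). u @ v"])
      show "inj_on (\<lambda>(u, v). u @ v) ?P"
        by (rule inj_onI) (auto simp: closed_walks_def)
      show "(\<lambda>(u, v). u @ v) ` ?P \<subseteq> ?A"
        by (auto simp: closed_walks_def)
      show "finite ?A"
        by (rule finite_subset[OF _ finite_lists_length_eq[of "{..<n}" "2 * k + 2"]]) auto
    qed
    also have "\<dots> \<le> k ^ (2 * k + 2) * n ^ k" by (rule card_lists_few_values) simp
    finally have P: "real (card ?P) \<le> real k ^ (2 * k + 2) * real n ^ k"
      by (simp only: of_nat_le_iff flip: of_nat_mult of_nat_power)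
    have int: "integrable M (\<lambda>\<omega>. \<Sum>w\<in>?W. \<Sum>u\<in>?W. Z w u \<omega>)"
      by (intro Bochner_Integration.integrable_sum Z(1))
    have "expectation (\<lambda>\<omega>. \<Sum>w\<in>?W. \<Sum>u\<in>?W. Z w u \<omega>) = (\<Sum>w\<in>?W. \<Sum>u\<in>?W. expectation (Z w u))"
      by (subst Bochner_Integration.integral_sum)
         (auto intro!: sum.cong Bochner_Integration.integral_sum
             Bochner_Integration.integrable_sum Z(1))
    also have "\<dots> \<le> (\<Sum>w\<in>?W. \<Sum>u\<in>?W. if card (set (w @ u)) \<le> k then B' + B * B else 0)"
      by (intro sum_mono Z_le)
    also have "\<dots> = (\<Sum>x\<in>?W \<times> ?W. if x \<in> ?P then B' + B * B else 0)"
      by (simp add: sum.cartesian_product case_prod_beta mem_Times_iff cong: if_cong)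
    also have "\<dots> = (B' + B * B) * real (card ?P)"
    proof -
      have "?W \<times> ?W \<inter> ?P = ?P" by auto
      then show ?thesis by (simp add: sum.If_cases)
    qed
    also have "\<dots> \<le> (B' + B * B) * (real k ^ (2 * k + 2) * real n ^ k)"
      using B(1) B'(1) P by (intro mult_left_mono) auto
    finally show ?thesis unfolding sq using int by (simp add: mult.assoc)
  qed
  then show ?thesis using that by blast
qed

subsection \<open>Almost sure convergence\<close>

text \<open>Dividing the variance bound of order n^k by the squared normalisation n^(k+2) leaves the
  summable n^(-2); the limit of the expectations then undoes the centering.\<close>

lemma trace_power_AE_tendsto:
  "AE \<omega> in M. (\<lambda>n. trace_power n k \<omega> / sqrt (real n) ^ (k + 2)) \<longlonglongrightarrow> semicircle_moment k"
proof -
  obtain C where int: "\<And>n. integrable M (\<lambda>\<omega>. (trace_power n k \<omega> - expectation (trace_power n k))\<^sup>2)"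
    and C: "\<And>n. expectation (\<lambda>\<omega>. (trace_power n k \<omega> - expectation (trace_power n k))\<^sup>2) \<le> C * real
        n ^ k"
    using trace_power_variance[of k] by blast
  let ?Z = "\<lambda>n \<omega>. (trace_power n k \<omega> - expectation (trace_power n k)) / sqrt (real n) ^ (k + 2)"
  have "(sqrt (real n) ^ (k + 2))\<^sup>2 = real n ^ (k + 2)" for n
    by (simp only: power_even_eq[symmetric] sqrt_power_even)
  then have Z2: "(\<lambda>\<omega>. (?Z n \<omega>)\<^sup>2) =
      (\<lambda>\<omega>. (trace_power n k \<omega> - expectation (trace_power n k))\<^sup>2 / real n ^ (k + 2))" for n
    by (simp only: power_divide)
  have "AE \<omega> in M. (\<lambda>n. ?Z n \<omega>) \<longlonglongrightarrow> 0"
  proof (rule AE_tendsto_0_of_summable_second_moment)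
    show "integrable M (\<lambda>\<omega>. (?Z n \<omega>)\<^sup>2)" for n unfolding Z2 using int by simp
    show "summable (\<lambda>n. expectation (\<lambda>\<omega>. (?Z n \<omega>)\<^sup>2))"
    proof (rule summable_comparison_test)
      show "summable (\<lambda>n. C * inverse (real n ^ 2))"
        by (intro summable_mult inverse_power_summable) simp
      have "norm (expectation (\<lambda>\<omega>. (?Z n \<omega>)\<^sup>2)) \<le> C * inverse (real n ^ 2)" for n
      \<comment> \<open>At \<open>n = 0\<close> both sides are 0, because division by 0 yields
        0.\<close>
      proof (cases "n = 0")
        case False
        have "expectation (\<lambda>\<omega>. (?Z n \<omega>)\<^sup>2) =
            expectation (\<lambda>\<omega>. (trace_power n k \<omega> - expectation (trace_power n k))\<^sup>2) / real n ^ (k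
                + 2)"
          unfolding Z2 by simp
        also have "\<dots> \<le> C * real n ^ k / real n ^ (k + 2)" by (intro divide_right_mono C) simp
        also have "\<dots> = C * inverse (real n ^ 2)" using False by (simp add: field_simps power_add
            power2_eq_square)
        finally show ?thesis by simp
      qed (simp add: power2_eq_square)
      then show "\<exists>N. \<forall>n\<ge>N. norm (expectation (\<lambda>\<omega>. (?Z n \<omega>)\<^sup>2)) \<le> C * inverse (real n ^ 2)" by blast
    qed
  qed
  then show ?thesis
  proof (rule AE_mp, intro AE_I2 impI)
    fix \<omega> assume "(\<lambda>n. ?Z n \<omega>) \<longlonglongrightarrow> 0"
    from tendsto_add[OF this expectation_trace_power_tendsto[of k]]
    show "(\<lambda>n. trace_power n k \<omega> / sqrt (real n) ^ (k + 2)) \<longlonglongrightarrow> semicircle_moment k"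
      by (simp add: diff_divide_distrib)
  qed
qed

text \<open>The exponent \<open>k + 2\<close> combines \<open>k\<close> factors 1 / sqrt n from the
  scaled entries with the factor 1 / n of the spectral distribution.\<close>

lemma esd_moment_wigner_matrix:
  assumes \<omega>: "\<omega> \<in> space M" and n: "0 < n"
  shows "integral\<^sup>L (esd (wigner_matrix X n \<omega>)) (\<lambda>x. x ^ k) = trace_power n k \<omega> / sqrt (real n) ^
      (k + 2)"
proof -
  let ?W = "wigner_matrix X n \<omega>"
  have W: "?W \<in> carrier_mat n n" by (simp add: wigner_matrix_def)
  have sym: "transpose_mat ?W = ?W"
    by (rule eq_matI) (auto simp: wigner_matrix_def symmetric_entries[OF _ _ \<omega>])
  let ?a = "\<lambda>e. 1 / sqrt (real n) * X n (fst e) (snd e) \<omega>"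
  have a: "?W $$ (i, j) = ?a (edge i j)" if "i < n" "j < n" for i j
    using that symmetric_entries[OF that \<omega>] by (simp add: wigner_matrix_def edge_def min_def
        max_def)
  have prod: "(\<Prod>e\<leftarrow>xs. ?a e) = edge_product n xs \<omega> / sqrt (real n) ^ length xs" for xs
    by (induction xs) (simp_all add: edge_product_def)
  have "integral\<^sup>L (esd ?W) (\<lambda>x. x ^ k) = (\<Sum>l<n. (eigenvalue_list ?W ! l) ^ k) / real n"
    using W n by (subst integral_esd) auto
  also have "(\<Sum>l<n. (eigenvalue_list ?W ! l) ^ k) = (\<Sum>w\<in>closed_walks n k. \<Prod>e\<leftarrow>steps w. ?a e)"
    unfolding sum_list_eigenvalue_powers[OF W sym] by (rule sum_diag_pow_eq_sum_closed_walks[OF W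
        a])
  also have "\<dots> = (\<Sum>w\<in>closed_walks n k. edge_product n (steps w) \<omega> / sqrt (real n) ^ k)"
    by (intro sum.cong refl) (simp only: prod length_steps_closed_walks)
  also have "\<dots> / real n = trace_power n k \<omega> / (sqrt (real n) ^ k * (sqrt (real n))\<^sup>2)"
    by (simp add: trace_power_def sum_divide_distrib)
  also have "sqrt (real n) ^ k * (sqrt (real n))\<^sup>2 = sqrt (real n) ^ (k + 2)"
    by (rule power_add[symmetric])
  finally show ?thesis .
qed

lemma semicircle_law: "AE \<omega> in M. weakly_converges (\<lambda>n. esd (wigner_matrix X n \<omega>))
    semicircle_distribution"
proof -
  \<comment> \<open>There is one exceptional null set for each moment, and countably many may be
    merged.\<close>
  have "AE \<omega> in M. \<forall>k. (\<lambda>n. trace_power n k \<omega> / sqrt (real n) ^ (k + 2)) \<longlonglongrightarrow> semicircle_moment k"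
    using trace_power_AE_tendsto by (simp add: AE_all_countable)
  then show ?thesis
  proof (rule AE_mp, intro AE_I2 impI)
    fix \<omega> assume \<omega>: "\<omega> \<in> space M"
      and lim: "\<forall>k. (\<lambda>n. trace_power n k \<omega> / sqrt (real n) ^ (k + 2)) \<longlonglongrightarrow> semicircle_moment k"
    let ?\<mu> = "\<lambda>n. esd (wigner_matrix X n \<omega>)"
    have dim: "dim_row (wigner_matrix X n \<omega>) = n" for n by (simp add: wigner_matrix_def)
    \<comment> \<open>At \<open>n = 0\<close> there is no eigenvalue and no probability measure, so
      the sequence is shifted by one and the limit is transferred back at the end.\<close>
    have distr: "real_distribution (?\<mu> (Suc n))" for n
      by (rule real_distribution_esd) (simp add: dim)
    have "weak_conv_m (\<lambda>n. ?\<mu> (Suc n)) semicircle_distribution"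
    proof (rule weak_conv_m_of_moments[OF distr real_distribution_semicircle])
      show "integrable (?\<mu> (Suc n)) (\<lambda>x. x ^ k)" for n k
        by (rule integrable_esd) (simp_all add: dim)
      show "(\<lambda>n. integral\<^sup>L (?\<mu> (Suc n)) (\<lambda>x. x ^ k)) \<longlonglongrightarrow> integral\<^sup>L semicircle_distribution (\<lambda>x. x
          ^ k)" for k
        using LIMSEQ_Suc[OF lim[rule_format, of k]]
        by (simp only: integral_semicircle esd_moment_wigner_matrix[OF \<omega> zero_less_Suc])
      \<comment> \<open>The growth bound 4^m of the Catalan numbers is the moment bound with
        \<open>R = 2\<close>, the right end of the support.\<close>
      show "integral\<^sup>L semicircle_distribution (\<lambda>x. x ^ (2 * m)) \<le> 2 ^ (2 * m)" for m
        unfolding integral_semicircle using catalan_le[of m] by (simp add: semicircle_moment_def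
            power_mult)
    qed (rule integrable_semicircle)
    then have conv: "weakly_converges (\<lambda>n. ?\<mu> (Suc n)) semicircle_distribution"
      by (simp add: weakly_converges_iff_weak_conv_m distr real_distribution_semicircle)
    show "weakly_converges ?\<mu> semicircle_distribution"
      unfolding weakly_converges_def
    proof (intro allI impI)
      fix f :: "real \<Rightarrow> real" assume "continuous_on UNIV f" "bounded (range f)"
      with conv have "(\<lambda>n. integral\<^sup>L (?\<mu> (Suc n)) f) \<longlonglongrightarrow> integral\<^sup>L semicircle_distribution f"
        unfolding weakly_converges_def by blast
      then show "(\<lambda>n. integral\<^sup>L (?\<mu> n) f) \<longlonglongrightarrow> integral\<^sup>L semicircle_distribution f"
        by (rule LIMSEQ_imp_Suc)
    qed
  qed
qed

end

theorem theorem2p42: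
  fixes M :: "'a measure" and X :: "nat \<Rightarrow> nat \<Rightarrow> nat \<Rightarrow> 'a \<Rightarrow> real"
  assumes "wigner_scheme M X"
  shows "AE \<omega> in M. weakly_converges (\<lambda>n. esd (wigner_matrix X n \<omega>)) semicircle_distribution"
  using assms by (rule wigner_scheme.semicircle_law)

end
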